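(* Fix integers $d\ge1$ and $r\ge2$ and a constant $C>0$, and let $n=\sum_{i=1}^r n_i$ with proportions $n_i/n\to\lambda_i\in(\varepsilon,1-\varepsilon)$ for $1\le i\le r$ (with $\varepsilon>0$ fixed). Define $p(k)$ by \[ \genfrac{[}{]}{0pt}{}{n}{n_1,\dots,n_r}_q=\frac{(q)_n}{(q)_{n_1}\cdots(q)_{n_r}}=\sum_{k=0}^{M}p(k)\,q^k,\qquad M=\sum_{1\le i<j\le r}n_in_j, \] and set \[ \mu=\frac12\sum_{i<j}n_in_j,\qquad \sigma^2=\frac1{12}\sum_{i<j}n_in_j\,(n_i+n_j+1),\qquad \delta=\frac1{\sqrt2\,\sigma}, \] \[ \mathcal J^{d,m}(X):=\frac{\delta^{-d}}{p(m)}\,J^{d,m}\big(\delta X-1;\,p\big),\qquad \mathcal W:=\{m\in\mathbb Z:\ |m-\mu|\le C\,\sigma\}. \] Then for all sufficiently large $n$ and every $m\in\mathcal W$, the polynomial $\mathcal J^{d,m}(X)$ is real-rooted. Moreover, for all sufficiently large $n$, for every $1\le s\le d$ and every $k\in\mathcal W$, one has \[ (\mathcal L^{s}p)_k\ \ge\ 0 . \]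
   Context: The $n_i$ are nonnegative integers and $(q)_n:=\prod_{j=1}^n(1-q^j)$, $(q)_0:=1$. Set $p(k)=0$ for $k\notin\{0,\dots,M\}$. For a sequence $u=(u_k)_{k\in\mathbb Z}$ and integers $m\in\mathbb{Z}$, $d\ge0$, the degree $d$ index $m$ Jensen polynomial is $J^{d,m}(X;u):=\sum_{j=0}^{d}\binom dj u_{m+j}X^j$. A polynomial is real-rooted if all its zeros are real. For a finite sequence $u=(u_k)_{k=0}^{N}$, with the convention $u_{-1}=u_{N+1}=0$, the operator $\mathcal L$ is $(\mathcal Lu)_k:=u_k^2-u_{k-1}u_{k+1}$, and $\mathcal L^s$ denotes its $s$-fold iterate; here it is applied to $(p(k))_{k=0}^{M}$. "Sufficiently large" may depend on $d$, $r$, the limiting proportions $\lambda=(\lambda_1,\dots,\lambda_r)$, and $C$. *)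

theory Defs
  imports Complex_Main "HOL-Computational_Algebra.Polynomial"
begin

definition qpoch :: "nat \<Rightarrow> real poly" where
  "qpoch n = (\<Prod>j=1..n. 1 - monom 1 j)"

lemma qpoch_0 [simp]: "qpoch 0 = 1"
  by (simp add: qpoch_def)

lemma qpoch_Suc: "qpoch (Suc n) = qpoch n * (1 - monom 1 (Suc n))"
  by (simp add: qpoch_def mult.commute)

lemma qpoch_nonzero: "qpoch n \<noteq> 0"
proof (induction n)
  case (Suc n)
  have "coeff (1 - monom 1 (Suc n) :: real poly) 0 \<noteq> 0"
    by simp
  then have "1 - monom 1 (Suc n) \<noteq> (0 :: real poly)"
    by (metis coeff_0)
  with Suc show ?case
    by (simp add: qpoch_Suc del: right_minus_eq)
qed simp

text \<open>A multiplicity vector \<open>ns\<close> is read at the indices \<open>1, \<dots>, r\<close> only.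
  The polynomial division below is exact: see \<open>qmultinomial_exact\<close>.\<close>

definition qmultinomial :: "nat \<Rightarrow> (nat \<Rightarrow> nat) \<Rightarrow> real poly" where
  "qmultinomial r ns = qpoch (\<Sum>i=1..r. ns i) div (\<Prod>i=1..r. qpoch (ns i))"

lemma qpoch_mult_dvd: "qpoch a * qpoch b dvd qpoch (a + b)"
proof (induction "a + b" arbitrary: a b)
  case (Suc n)
  show ?case
  proof (cases "a = 0 \<or> b = 0")
    case False
    then obtain a' b' where ab: "a = Suc a'" "b = Suc b'"
      by (meson not0_implies_Suc)
    have n: "n = a' + b" "n = a + b'"
      using Suc.hyps(2) ab by auto
    have "qpoch a' * qpoch b dvd qpoch n" "qpoch a * qpoch b' dvd qpoch n"
      using Suc.hyps(1) n by metis+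
    then have 1: "qpoch a * qpoch b dvd qpoch n * (1 - monom 1 a)"
      and 2: "qpoch a * qpoch b dvd qpoch n * (1 - monom 1 b)"
      by (auto simp: ab qpoch_Suc mult_ac intro: mult_dvd_mono)
    have "monom 1 (a + b) = monom 1 a * (monom 1 b :: real poly)"
      by (simp add: mult_monom)
    then have "qpoch (a + b) =
        qpoch n * (1 - monom 1 a) + monom 1 a * (qpoch n * (1 - monom 1 b))"
      using Suc.hyps(2) qpoch_Suc[of n] by (simp add: algebra_simps)
    with 1 2 show ?thesis
      by (simp add: dvd_add dvd_mult)
  qed auto
qed simp

lemma qmultinomial_exact:
  "qmultinomial r ns * (\<Prod>i=1..r. qpoch (ns i)) = qpoch (\<Sum>i=1..r. ns i)"
proof -
  have "(\<Prod>i=1..r. qpoch (ns i)) dvd qpoch (\<Sum>i=1..r. ns i)"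
  proof (induction r)
    case (Suc r)
    have "(\<Prod>i=1..r. qpoch (ns i)) * qpoch (ns (Suc r))
        dvd qpoch (\<Sum>i=1..r. ns i) * qpoch (ns (Suc r))"
      using Suc by (intro mult_dvd_mono) auto
    also have "\<dots> dvd qpoch ((\<Sum>i=1..r. ns i) + ns (Suc r))"
      by (rule qpoch_mult_dvd)
    finally show ?case by (simp add: mult.commute)
  qed simp
  then show ?thesis by (simp add: qmultinomial_def)
qed

definition qmult_deg :: "nat \<Rightarrow> (nat \<Rightarrow> nat) \<Rightarrow> nat" where
  "qmult_deg r ns = (\<Sum>i=1..r. \<Sum>j\<in>{i<..r}. ns i * ns j)"

definition qmult_coeff :: "nat \<Rightarrow> (nat \<Rightarrow> nat) \<Rightarrow> int \<Rightarrow> real" where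
  "qmult_coeff r ns k =
     (if 0 \<le> k \<and> k \<le> int (qmult_deg r ns) then coeff (qmultinomial r ns) (nat k) else 0)"

definition qmult_mean :: "nat \<Rightarrow> (nat \<Rightarrow> nat) \<Rightarrow> real" where
  "qmult_mean r ns = (1 / 2) * (\<Sum>i=1..r. \<Sum>j\<in>{i<..r}. real (ns i) * real (ns j))"

definition qmult_var :: "nat \<Rightarrow> (nat \<Rightarrow> nat) \<Rightarrow> real" where
  "qmult_var r ns =
     (1 / 12) * (\<Sum>i=1..r. \<Sum>j\<in>{i<..r}. real (ns i) * real (ns j) * (real (ns i) + real (ns j) + 1))"

definition qmult_sd :: "nat \<Rightarrow> (nat \<Rightarrow> nat) \<Rightarrow> real" where
  "qmult_sd r ns = sqrt (qmult_var r ns)"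

definition qmult_delta :: "nat \<Rightarrow> (nat \<Rightarrow> nat) \<Rightarrow> real" where
  "qmult_delta r ns = 1 / (sqrt 2 * qmult_sd r ns)"

definition window :: "real \<Rightarrow> nat \<Rightarrow> (nat \<Rightarrow> nat) \<Rightarrow> int set" where
  "window C r ns = {m. \<bar>real_of_int m - qmult_mean r ns\<bar> \<le> C * qmult_sd r ns}"

definition jensen :: "nat \<Rightarrow> int \<Rightarrow> (int \<Rightarrow> real) \<Rightarrow> real poly" where
  "jensen d m u = (\<Sum>j=0..d. monom (real (d choose j) * u (m + int j)) j)"

definition scaled_jensen :: "nat \<Rightarrow> int \<Rightarrow> nat \<Rightarrow> (nat \<Rightarrow> nat) \<Rightarrow> real poly" where
  "scaled_jensen d m r ns =
     smult (qmult_delta r ns powi (- int d) / qmult_coeff r ns m)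
       (jensen d m (qmult_coeff r ns) \<circ>\<^sub>p [:- 1, qmult_delta r ns:])"

definition real_rooted :: "real poly \<Rightarrow> bool" where
  "real_rooted f \<longleftrightarrow> (\<forall>z::complex. poly (map_poly complex_of_real f) z = 0 \<longrightarrow> z \<in> \<real>)"

text \<open>A finite sequence \<open>u\<close> on \<open>{0..N}\<close> is represented by its extension by zero to
  all integers. This realises the boundary convention \<open>u (- 1) = u (N + 1) = 0\<close>
  at every iteration, since the iterates again vanish outside \<open>{0..N}\<close>.\<close>

definition turan_op :: "(int \<Rightarrow> real) \<Rightarrow> int \<Rightarrow> real" where
  "turan_op u k = (u k)\<^sup>2 - u (k - 1) * u (k + 1)"

lemma turan_op_iterate_outside:
  assumes "\<And>k. k \<notin> {0..N} \<Longrightarrow> u k = 0" and "k \<notin> {0..N}"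
  shows "(turan_op ^^ s) u k = 0"
  using assms(2)
proof (induction s arbitrary: k)
  case (Suc s)
  from Suc.prems have "k - 1 \<notin> {0..N} \<or> k + 1 \<notin> {0..N}" by auto
  with Suc show ?case by (auto simp: turan_op_def)
qed (simp add: assms(1))

end

theory Submission
  imports Defs "HOL-Probability.Probability" "HOL-Real_Asymp.Real_Asymp"
begin

text \<open>
  Everything follows from a local limit theorem for \<open>p\<close> that also controls all finite differences:
  with \<open>x = (m - \<mu>) / \<sigma>\<close> and \<open>g\<close> the standard normal density, \<open>\<sigma> ^ (i + 1) * \<Delta>\<^sup>i p(m)\<close>, divided by the
  multinomial coefficient, tends to the \<open>i\<close>-th derivative of \<open>g\<close> at \<open>x\<close>. Hence the Jensen polynomials, suitably
  rescaled, tend to a positive multiple of the Hermite polynomial \<open>He\<^sub>d(x + X)\<close>, whose zeros are real and simple,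
  and \<open>\<L>\<close> acts in the limit as \<open>G \<mapsto> G'\<^sup>2 - G * G''\<close>, which maps \<open>c * exp (- a * x\<^sup>2 / 2)\<close> to
  \<open>a * c\<^sup>2 * exp (- a * x\<^sup>2)\<close>, a function of the same form.

  The local limit theorem is proved by Fourier inversion and dominated convergence. The generating function is a
  product of \<open>q\<close>-binomial coefficients. For \<open>\<bar>\<theta>\<bar> < 2 * pi / n\<close> the product formula for these at \<open>q = cis \<theta>\<close>
  gives a Gaussian bound, because \<open>sin x / x * exp (x\<^sup>2 / 6)\<close> decreases on \<open>(0, pi)\<close>. For
  \<open>2 * pi / n \<le> \<bar>\<theta>\<bar> \<le> pi\<close> the \<open>q\<close>-binomial theorem together with Cauchy's estimate on a circle of suitable
  radius gives an exponentially small bound.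
\<close>

section \<open>Convergence together with scaled differences\<close>

text \<open>Both a Jensen polynomial near -1 and \<open>turan_op\<close> combine neighbouring values
  whose leading terms cancel, so a limit for the values alone leaves an error that swamps the
  quantity sought. Each difference gains a factor 1 / \<sigma>; hence the limit has to cover
  differences of every order, packaged in \<open>smooth_conv\<close> so as to respect sums, products
  and shifts. The frequency 2 * pi / n is where the two bounds meet. Below it all half-angles k *
  \<bar>\<theta>\<bar> / 2 with 1 \<le> k \<le> n lie in (0, pi), where the sines are positive. From
  it on, a sum of n cosines in arithmetic progression is at most n / 2, which leaves a definite
  exponent in Cauchy's estimate. That estimate is applied to a single Gaussian factor, both of whose
  parts are at least eps * n; the exponent is therefore linear in n and outweighs the polynomial
  length of the rescaled integration range. Limits are stated along arbitrary index sequences with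
  convergent normalised position, so uniformity over the window comes from compactness rather than
  from error terms.\<close>

definition fdiff :: "(int \<Rightarrow> real) \<Rightarrow> int \<Rightarrow> real" where
  "fdiff u k = u (k + 1) - u k"

text \<open>Near \<open>\<mu> + \<sigma> * x\<close> the sequence \<open>u / A\<close> is close to \<open>G x\<close>, and likewise for its first \<open>n\<close> differences,
  each multiplied by a further factor \<open>\<sigma>\<close>, and the corresponding derivatives of \<open>G\<close>.\<close>

primrec smooth_conv :: "(nat \<Rightarrow> real) \<Rightarrow> (nat \<Rightarrow> real) \<Rightarrow> nat \<Rightarrow>
    (nat \<Rightarrow> int \<Rightarrow> real) \<Rightarrow> (nat \<Rightarrow> real) \<Rightarrow> (real \<Rightarrow> real) \<Rightarrow> bool" where
  "smooth_conv \<mu> \<sigma> 0 u A G \<longleftrightarrow>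
     (\<forall>m x. (\<lambda>j. (real_of_int (m j) - \<mu> j) / \<sigma> j) \<longlonglongrightarrow> x \<longrightarrow> (\<lambda>j. u j (m j) / A j) \<longlonglongrightarrow> G x)"
| "smooth_conv \<mu> \<sigma> (Suc n) u A G \<longleftrightarrow>
     (\<forall>m x. (\<lambda>j. (real_of_int (m j) - \<mu> j) / \<sigma> j) \<longlonglongrightarrow> x \<longrightarrow> (\<lambda>j. u j (m j) / A j) \<longlonglongrightarrow> G x) \<and>
     (\<exists>G'. (\<forall>x. (G has_real_derivative G' x) (at x)) \<and>
           smooth_conv \<mu> \<sigma> n (\<lambda>j. fdiff (u j)) (\<lambda>j. A j / \<sigma> j) G')"

lemma smooth_conv_tendsto:
  assumes "smooth_conv \<mu> \<sigma> n u A G" "(\<lambda>j. (real_of_int (m j) - \<mu> j) / \<sigma> j) \<longlonglongrightarrow> x"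
  shows "(\<lambda>j. u j (m j) / A j) \<longlonglongrightarrow> G x"
proof -
  have "\<forall>m x. (\<lambda>j. (real_of_int (m j) - \<mu> j) / \<sigma> j) \<longlonglongrightarrow> x \<longrightarrow> (\<lambda>j. u j (m j) / A j) \<longlonglongrightarrow> G x"
    using assms(1) by (cases n) simp_all
  with assms(2) show ?thesis by blast
qed

lemma smooth_conv_SucI:
  assumes "\<And>m x. (\<lambda>j. (real_of_int (m j) - \<mu> j) / \<sigma> j) \<longlonglongrightarrow> x \<Longrightarrow> (\<lambda>j. u j (m j) / A j) \<longlonglongrightarrow> G x"
    and "\<And>x. (G has_real_derivative G' x) (at x)"
    and "smooth_conv \<mu> \<sigma> n (\<lambda>j. fdiff (u j)) (\<lambda>j. A j / \<sigma> j) G'"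
  shows "smooth_conv \<mu> \<sigma> (Suc n) u A G"
  using assms unfolding smooth_conv.simps by blast

lemma smooth_conv_lower: "smooth_conv \<mu> \<sigma> (Suc n) u A G \<Longrightarrow> smooth_conv \<mu> \<sigma> n u A G"
proof (induction n arbitrary: u A G)
  case (Suc n)
  from Suc.prems obtain G' where "\<And>x. (G has_real_derivative G' x) (at x)"
    "smooth_conv \<mu> \<sigma> (Suc n) (\<lambda>j. fdiff (u j)) (\<lambda>j. A j / \<sigma> j) G'"
    unfolding smooth_conv.simps(2)[of _ _ "Suc n"] by blast
  then show ?case
    by (intro smooth_conv_SucI[of \<mu> \<sigma> u A G G'] smooth_conv_tendsto[OF Suc.prems] Suc.IH)
qed simp

text \<open>The derivative in \<open>smooth_conv\<close> is existentially quantified; uniqueness of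
  derivatives lets any known derivative of \<open>G\<close> take its place.\<close>

lemma smooth_conv_fdiff:
  assumes "smooth_conv \<mu> \<sigma> (Suc n) u A G" "\<And>x. (G has_real_derivative G' x) (at x)"
  shows "smooth_conv \<mu> \<sigma> n (\<lambda>j. fdiff (u j)) (\<lambda>j. A j / \<sigma> j) G'"
proof -
  obtain H where H: "\<And>x. (G has_real_derivative H x) (at x)"
    "smooth_conv \<mu> \<sigma> n (\<lambda>j. fdiff (u j)) (\<lambda>j. A j / \<sigma> j) H"
    using assms(1) unfolding smooth_conv.simps by blast
  have "H = G'" using DERIV_unique[OF H(1) assms(2)] by auto
  with H show ?thesis by simp
qed

lemma shifted_index_tendsto:
  assumes "filterlim \<sigma> at_top sequentially" "(\<lambda>j. (real_of_int (m j) - \<mu> j) / \<sigma> j) \<longlonglongrightarrow> x"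
  shows "(\<lambda>j. (real_of_int (m j + c) - \<mu> j) / \<sigma> j) \<longlonglongrightarrow> x"
proof -
  have "(\<lambda>j. of_int c / \<sigma> j) \<longlonglongrightarrow> 0"
    using assms(1) by (intro real_tendsto_divide_at_top[OF tendsto_const])
  from tendsto_add[OF assms(2) this] show ?thesis
    by (simp add: add_divide_distrib diff_divide_distrib algebra_simps)
qed

lemma smooth_conv_shift:
  assumes \<sigma>: "filterlim \<sigma> at_top sequentially" and "smooth_conv \<mu> \<sigma> n u A G"
  shows "smooth_conv \<mu> \<sigma> n (\<lambda>j k. u j (k + c)) A G"
  using assms(2)
proof (induction n arbitrary: u A G)
  case 0
  show ?case unfolding smooth_conv.simps
    by (intro allI impI smooth_conv_tendsto[OF 0] shifted_index_tendsto[OF \<sigma>, of _ _ _ c])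
next
  case (Suc n)
  have eq: "fdiff (\<lambda>k. u j (k + c)) = (\<lambda>k. fdiff (u j) (k + c))" for j
    by (auto simp: fdiff_def fun_eq_iff algebra_simps)
  from Suc.prems obtain G' where "\<And>x. (G has_real_derivative G' x) (at x)"
    "smooth_conv \<mu> \<sigma> n (\<lambda>j. fdiff (u j)) (\<lambda>j. A j / \<sigma> j) G'" unfolding smooth_conv.simps by blast
  moreover have "(\<lambda>j. u j (m j + c) / A j) \<longlonglongrightarrow> G x"
    if "(\<lambda>j. (real_of_int (m j) - \<mu> j) / \<sigma> j) \<longlonglongrightarrow> x" for m x
    by (intro smooth_conv_tendsto[OF Suc.prems] shifted_index_tendsto[OF \<sigma> that])
  ultimately show ?case
    by (intro smooth_conv_SucI[of \<mu> \<sigma> _ A G G' n]) (simp_all add: eq Suc.IH[of "\<lambda>j. fdiff (u j)"])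
qed

lemma smooth_conv_add:
  assumes "smooth_conv \<mu> \<sigma> n u A G" "smooth_conv \<mu> \<sigma> n v A H"
  shows "smooth_conv \<mu> \<sigma> n (\<lambda>j k. u j k + v j k) A (\<lambda>x. G x + H x)"
  using assms
proof (induction n arbitrary: u v A G H)
  case 0
  show ?case unfolding smooth_conv.simps add_divide_distrib
    by (intro allI impI tendsto_add smooth_conv_tendsto[OF 0(1)] smooth_conv_tendsto[OF 0(2)])
next
  case (Suc n)
  have eq: "fdiff (\<lambda>k. u j k + v j k) = (\<lambda>k. fdiff (u j) k + fdiff (v j) k)" for j
    by (auto simp: fdiff_def)
  from Suc.prems obtain G' H' where D: "\<And>x. (G has_real_derivative G' x) (at x)"
      "\<And>x. (H has_real_derivative H' x) (at x)"
    and "smooth_conv \<mu> \<sigma> n (\<lambda>j. fdiff (u j)) (\<lambda>j. A j / \<sigma> j) G'"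
      "smooth_conv \<mu> \<sigma> n (\<lambda>j. fdiff (v j)) (\<lambda>j. A j / \<sigma> j) H'" unfolding smooth_conv.simps by blast
  then have "smooth_conv \<mu> \<sigma> n (\<lambda>j. fdiff (\<lambda>k. u j k + v j k)) (\<lambda>j. A j / \<sigma> j) (\<lambda>x. G' x + H' x)"
    unfolding eq by (intro Suc.IH)
  moreover have "((\<lambda>x. G x + H x) has_real_derivative G' x + H' x) (at x)" for x
    by (intro DERIV_add D)
  moreover have "(\<lambda>j. (u j (m j) + v j (m j)) / A j) \<longlonglongrightarrow> G x + H x"
    if "(\<lambda>j. (real_of_int (m j) - \<mu> j) / \<sigma> j) \<longlonglongrightarrow> x" for m x
    using Suc.prems[THEN smooth_conv_tendsto, OF that]
    by (auto simp: add_divide_distrib intro!: tendsto_add)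
  ultimately show ?case by (intro smooth_conv_SucI)
qed

lemma smooth_conv_mult:
  assumes \<sigma>: "filterlim \<sigma> at_top sequentially"
    and "smooth_conv \<mu> \<sigma> n u A G" "smooth_conv \<mu> \<sigma> n v B H"
  shows "smooth_conv \<mu> \<sigma> n (\<lambda>j k. u j k * v j k) (\<lambda>j. A j * B j) (\<lambda>x. G x * H x)"
  using assms(2,3)
proof (induction n arbitrary: u v A B G H)
  case 0
  have eq: "u j (m j) * v j (m j) / (A j * B j) = (u j (m j) / A j) * (v j (m j) / B j)" for m j by simp
  show ?case unfolding smooth_conv.simps eq
    by (intro allI impI tendsto_mult smooth_conv_tendsto[OF 0(1)] smooth_conv_tendsto[OF 0(2)])
next
  case (Suc n)
  \<comment> \<open>Discrete Leibniz rule. One factor is shifted by 1, which is where invariance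
    under shifts enters.\<close>
  have eq: "fdiff (\<lambda>k. u j k * v j k) = (\<lambda>k. fdiff (u j) k * v j k + u j (k + 1) * fdiff (v j) k)" for j
    by (auto simp: fdiff_def algebra_simps)
  from Suc.prems obtain G' H' where D: "\<And>x. (G has_real_derivative G' x) (at x)"
      "\<And>x. (H has_real_derivative H' x) (at x)"
    and u: "smooth_conv \<mu> \<sigma> n (\<lambda>j. fdiff (u j)) (\<lambda>j. A j / \<sigma> j) G'" and
      v: "smooth_conv \<mu> \<sigma> n (\<lambda>j. fdiff (v j)) (\<lambda>j. B j / \<sigma> j) H'" unfolding smooth_conv.simps by blast
  have "smooth_conv \<mu> \<sigma> n (\<lambda>j k. fdiff (u j) k * v j k) (\<lambda>j. A j * B j / \<sigma> j) (\<lambda>x. G' x * H x)"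
    using Suc.IH[OF u smooth_conv_lower[OF Suc.prems(2)]] by simp
  moreover have "smooth_conv \<mu> \<sigma> n (\<lambda>j k. u j (k + 1) * fdiff (v j) k) (\<lambda>j. A j * B j / \<sigma> j) (\<lambda>x. G x * H' x)"
    using Suc.IH[OF smooth_conv_shift[OF \<sigma> smooth_conv_lower[OF Suc.prems(1)]] v] by simp
  ultimately have "smooth_conv \<mu> \<sigma> n (\<lambda>j. fdiff (\<lambda>k. u j k * v j k)) (\<lambda>j. A j * B j / \<sigma> j)
      (\<lambda>x. G' x * H x + G x * H' x)"
    unfolding eq by (intro smooth_conv_add)
  moreover have "((\<lambda>x. G x * H x) has_real_derivative G' x * H x + G x * H' x) (at x)" for x
    using DERIV_mult[OF D, of x] by (simp add: mult.commute)
  moreover have "(\<lambda>j. (u j (m j) * v j (m j)) / (A j * B j)) \<longlonglongrightarrow> G x * H x"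
    if "(\<lambda>j. (real_of_int (m j) - \<mu> j) / \<sigma> j) \<longlonglongrightarrow> x" for m x
    using tendsto_mult[OF Suc.prems(1)[THEN smooth_conv_tendsto, OF that] Suc.prems(2)[THEN smooth_conv_tendsto, OF that]]
    by simp
  ultimately show ?case by (intro smooth_conv_SucI)
qed

lemma smooth_conv_cmult:
  assumes "smooth_conv \<mu> \<sigma> n u A G"
  shows "smooth_conv \<mu> \<sigma> n (\<lambda>j k. c * u j k) A (\<lambda>x. c * G x)"
  using assms
proof (induction n arbitrary: u A G)
  case 0
  show ?case unfolding smooth_conv.simps times_divide_eq_right[symmetric]
    by (intro allI impI tendsto_mult tendsto_const smooth_conv_tendsto[OF 0])
next
  case (Suc n)
  have eq: "fdiff (\<lambda>k. c * u j k) = (\<lambda>k. c * fdiff (u j) k)" for j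
    by (auto simp: fdiff_def algebra_simps)
  from Suc.prems obtain G' where D: "\<And>x. (G has_real_derivative G' x) (at x)"
    and "smooth_conv \<mu> \<sigma> n (\<lambda>j. fdiff (u j)) (\<lambda>j. A j / \<sigma> j) G'" unfolding smooth_conv.simps by blast
  then have "smooth_conv \<mu> \<sigma> n (\<lambda>j. fdiff (\<lambda>k. c * u j k)) (\<lambda>j. A j / \<sigma> j) (\<lambda>x. c * G' x)"
    unfolding eq by (intro Suc.IH)
  moreover have "((\<lambda>x. c * G x) has_real_derivative c * G' x) (at x)" for x
    by (intro DERIV_cmult D)
  moreover have "(\<lambda>j. c * u j (m j) / A j) \<longlonglongrightarrow> c * G x"
    if "(\<lambda>j. (real_of_int (m j) - \<mu> j) / \<sigma> j) \<longlonglongrightarrow> x" for m x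
    using tendsto_mult[OF tendsto_const Suc.prems(1)[THEN smooth_conv_tendsto, OF that], of c]
    by simp
  ultimately show ?case by (intro smooth_conv_SucI)
qed

text \<open>A difference divides the normaliser by \<open>\<sigma> j\<close>; multiplying the
  difference by \<open>\<sigma> j\<close> restores it, as happens in each step of the Jensen
  recursion.\<close>

lemma smooth_conv_rescale:
  assumes "smooth_conv \<mu> \<sigma> n u A G" "\<And>j. \<sigma> j > 0"
  shows "smooth_conv \<mu> \<sigma> n (\<lambda>j k. \<sigma> j * u j k) (\<lambda>j. \<sigma> j * A j) G"
proof -
  have nz: "\<sigma> j \<noteq> 0" for j using assms(2)[of j] by simp
  show ?thesis
    using assms(1)
  proof (induction n arbitrary: u A G)
    case 0
    then show ?case by (simp add: nz)
  next
    case (Suc n)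
    have eq: "fdiff (\<lambda>k. \<sigma> j * u j k) = (\<lambda>k. \<sigma> j * fdiff (u j) k)" for j
      by (auto simp: fdiff_def algebra_simps)
    from Suc.prems obtain G' where D: "\<And>x. (G has_real_derivative G' x) (at x)"
      and *: "smooth_conv \<mu> \<sigma> n (\<lambda>j. fdiff (u j)) (\<lambda>j. A j / \<sigma> j) G'" unfolding smooth_conv.simps by blast
    then have "smooth_conv \<mu> \<sigma> n (\<lambda>j. fdiff (\<lambda>k. \<sigma> j * u j k)) (\<lambda>j. \<sigma> j * A j / \<sigma> j) G'"
      unfolding eq using Suc.IH[OF *] by simp
    moreover have "(\<lambda>j. \<sigma> j * u j (m j) / (\<sigma> j * A j)) \<longlonglongrightarrow> G x"
      if "(\<lambda>j. (real_of_int (m j) - \<mu> j) / \<sigma> j) \<longlonglongrightarrow> x" for m x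
      using smooth_conv_tendsto[OF Suc.prems that] by (simp add: nz)
    ultimately show ?case using D by (intro smooth_conv_SucI)
  qed
qed

text \<open>With \<open>v k = u (k - 1)\<close> and \<Delta> for \<open>fdiff\<close>,
  \<open>turan_op u\<close> equals \<open>(\<Delta> v)\<^sup>2 - v * \<Delta> (\<Delta> v)\<close>:
  the undifferenced squares cancel exactly and each remaining term carries two differences. Hence
  the normaliser \<open>(A j / \<sigma> j)\<^sup>2\<close> and the loss of two orders.\<close>

lemma smooth_conv_turan_op:
  assumes \<sigma>: "filterlim \<sigma> at_top sequentially"
    and u: "smooth_conv \<mu> \<sigma> (Suc (Suc n)) u A G"
    and D: "\<And>x. (G has_real_derivative G' x) (at x)" "\<And>x. (G' has_real_derivative G'' x) (at x)"
  shows "smooth_conv \<mu> \<sigma> n (\<lambda>j. turan_op (u j)) (\<lambda>j. (A j / \<sigma> j)\<^sup>2) (\<lambda>x. (G' x)\<^sup>2 - G x * G'' x)"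
proof -
  define v where "v = (\<lambda>j k. u j (k + (-1)))"
  have eq: "turan_op (u j) = (\<lambda>k. fdiff (v j) k * fdiff (v j) k + (- 1) * (v j k * fdiff (fdiff (v j)) k))" for j
    by (auto simp: fun_eq_iff turan_op_def fdiff_def v_def power2_eq_square algebra_simps)
  have v: "smooth_conv \<mu> \<sigma> (Suc (Suc n)) v A G"
    unfolding v_def by (intro smooth_conv_shift \<sigma> u)
  note v1 = smooth_conv_fdiff[OF v D(1)]
  note v2 = smooth_conv_fdiff[OF v1 D(2)]
  have 1: "smooth_conv \<mu> \<sigma> n (\<lambda>j k. fdiff (v j) k * fdiff (v j) k) (\<lambda>j. (A j / \<sigma> j)\<^sup>2) (\<lambda>x. G' x * G' x)"
    unfolding power2_eq_square
    by (intro smooth_conv_mult \<sigma> smooth_conv_lower[OF v1])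
  have "smooth_conv \<mu> \<sigma> n (\<lambda>j k. v j k * fdiff (fdiff (v j)) k) (\<lambda>j. A j * (A j / \<sigma> j / \<sigma> j)) (\<lambda>x. G x * G'' x)"
    by (intro smooth_conv_mult \<sigma> v2 smooth_conv_lower[OF smooth_conv_lower[OF v]])
  then have "smooth_conv \<mu> \<sigma> n (\<lambda>j k. v j k * fdiff (fdiff (v j)) k) (\<lambda>j. (A j / \<sigma> j)\<^sup>2) (\<lambda>x. G x * G'' x)"
    by (simp add: power2_eq_square)
  from smooth_conv_add[OF 1 smooth_conv_cmult[OF this, of "- 1"]]
  have "smooth_conv \<mu> \<sigma> n (\<lambda>j k. fdiff (v j) k * fdiff (v j) k + (- 1) * (v j k * fdiff (fdiff (v j)) k))
     (\<lambda>j. (A j / \<sigma> j)\<^sup>2) (\<lambda>x. G' x * G' x + (- 1) * (G x * G'' x))" .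
  then show ?thesis by (simp add: eq power2_eq_square)
qed

section \<open>Hermite polynomials and sign alternation\<close>

text \<open>The probabilists' family. The recursion is the one obtained by differentiating a Hermite
  polynomial times the normal density and changing the sign.\<close>

primrec hermite :: "nat \<Rightarrow> real poly" where
  "hermite 0 = 1"
| "hermite (Suc n) = [:0, 1:] * hermite n - pderiv (hermite n)"

lemma std_normal_density_deriv:
  "(std_normal_density has_real_derivative - x * std_normal_density x) (at x)"
  unfolding std_normal_density_def[abs_def]
  by (auto intro!: derivative_eq_intros simp: field_simps)

text \<open>The logarithmic derivative \<open>- x\<close> of the density is split as
  \<open>a - (x + a)\<close>, and the second part feeds the Hermite recursion at
  \<open>x + a\<close>. The case \<open>a = 0\<close> gives the derivatives of the density; general
  \<open>a\<close> plays the role of the Jensen variable.\<close>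

lemma hermite_density_deriv:
  "((\<lambda>x. poly (hermite n) (x + a) * std_normal_density x) has_real_derivative
     a * (poly (hermite n) (x + a) * std_normal_density x)
       - poly (hermite (Suc n)) (x + a) * std_normal_density x) (at x)"
proof -
  have "((\<lambda>x. poly (hermite n) (x + a)) has_real_derivative poly (pderiv (hermite n)) (x + a)) (at x)"
    by (auto intro!: derivative_eq_intros)
  from DERIV_mult[OF this std_normal_density_deriv] show ?thesis
    by (simp add: algebra_simps)
qed

lemma tendsto_poly_exp_0:
  "((\<lambda>x. poly p x * std_normal_density x) \<longlongrightarrow> 0) at_top"
proof -
  have "((\<lambda>x::real. x ^ i * exp (- x\<^sup>2 / 2)) \<longlongrightarrow> 0) at_top" for i :: nat
    by real_asymp
  then have "((\<lambda>x. \<Sum>i\<le>degree p. coeff p i * (1 / sqrt (2 * pi)) * (x ^ i * exp (- x\<^sup>2 / 2))) \<longlongrightarrow>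
     (\<Sum>i\<le>degree p. coeff p i * (1 / sqrt (2 * pi)) * 0)) at_top"
    by (intro tendsto_sum tendsto_mult tendsto_const)
  then show ?thesis
    by (simp add: poly_altdef std_normal_density_def sum_distrib_left sum_divide_distrib mult_ac)
qed

lemma tendsto_poly_exp_0_bot:
  "((\<lambda>x. poly p x * std_normal_density x) \<longlongrightarrow> 0) at_bot"
proof -
  have "((\<lambda>x. poly (p \<circ>\<^sub>p [:0, -1:]) x * std_normal_density x) \<longlongrightarrow> 0) at_top"
    by (rule tendsto_poly_exp_0)
  then show ?thesis
    by (simp add: filterlim_at_bot_mirror poly_pcompose std_normal_density_def)
qed

text \<open>\<open>n\<close> sign changes with \<open>n + 1\<close> witnesses, the first value being
  positive. Finitely many strict inequalities survive pointwise convergence, so the convergence of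
  zeros never has to be discussed.\<close>

definition alternates :: "nat \<Rightarrow> (real \<Rightarrow> real) \<Rightarrow> bool" where
  "alternates n f \<longleftrightarrow> (\<exists>a. (\<forall>i<n. a i < a (Suc i)) \<and> (\<forall>i\<le>n. (- 1) ^ i * f (a i) > 0))"

text \<open>Besides the points between consecutive alternation points of \<open>f\<close>, the decay of \<open>f\<close> provides one more
  point on either side.\<close>

lemma alternates_deriv:
  fixes f :: "real \<Rightarrow> real"
  assumes alt: "alternates n f" and D: "\<And>x. (f has_real_derivative f' x) (at x)"
    and lim: "(f \<longlongrightarrow> 0) at_top" "(f \<longlongrightarrow> 0) at_bot"
  shows "alternates (Suc n) f'"
proof -
  obtain a where a: "\<And>i. i < n \<Longrightarrow> a i < a (Suc i)" "\<And>i. i \<le> n \<Longrightarrow> (- 1) ^ i * f (a i) > 0"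
    using alt by (auto simp: alternates_def)
  have mvt: "\<exists>z. x < z \<and> z < y \<and> f y - f x = (y - x) * f' z" if "x < y" for x y
    using MVT2[OF that] D by blast
  \<comment> \<open>The \<open>i\<close>-th new point lies between \<open>a (i - 1)\<close> and
    \<open>a i\<close>, without a left bound for \<open>i = 0\<close> and without a right bound for
    \<open>i = n + 1\<close>. Consecutive new points are thus separated by an old one.\<close>
  have "\<exists>z. (i = 0 \<or> a (i - 1) < z) \<and> (i \<le> n \<longrightarrow> z < a i) \<and> (- 1) ^ i * f' z > 0" if "i \<le> Suc n" for i
  proof -
    consider "i = 0" | "0 < i" "i \<le> n" | "i = Suc n" using \<open>i \<le> Suc n\<close> by linarith
    then show ?thesis
    proof cases
      case 1
      have "eventually (\<lambda>x. f x < f (a 0)) at_bot"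
        using a(2)[of 0] by (intro order_tendstoD[OF lim(2)]) auto
      moreover have "eventually (\<lambda>x. x < a 0) at_bot" by simp
      ultimately have "eventually (\<lambda>x. f x < f (a 0) \<and> x < a 0) at_bot" by (rule eventually_conj)
      then obtain x where x: "f x < f (a 0)" "x < a 0"
        by (metis (mono_tags, lifting) eventually_at_bot_linorder order_refl)
      then obtain z where "x < z" "z < a 0" "f (a 0) - f x = (a 0 - x) * f' z" using mvt by blast
      moreover from this have "0 < f' z" using x by (metis diff_gt_0_iff_gt zero_less_mult_pos)
      ultimately show ?thesis using 1 by (intro exI[of _ z]) auto
    next
      case 2
      then obtain k where k: "i = Suc k" by (cases i) auto
      have lt: "a k < a (Suc k)" using a(1)[of k] 2 k by auto
      then obtain z where z: "a k < z" "z < a (Suc k)" "f (a (Suc k)) - f (a k) = (a (Suc k) - a k) * f' z"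
        using mvt by blast
      have "0 < (- 1) ^ i * (f (a (Suc k)) - f (a k))"
        using a(2)[of k] a(2)[of "Suc k"] 2 k by (auto simp: algebra_simps)
      then have "0 < (a (Suc k) - a k) * ((- 1) ^ i * f' z)"
        unfolding z(3) by (simp add: algebra_simps)
      then have "0 < (- 1) ^ i * f' z" using lt by (metis diff_gt_0_iff_gt zero_less_mult_pos)
      then show ?thesis using z k by (intro exI[of _ z]) auto
    next
      case 3
      have "((\<lambda>x. (- 1) ^ n * f x) \<longlongrightarrow> 0) at_top"
        using tendsto_mult[OF tendsto_const lim(1), of "(- 1) ^ n"] by simp
      then have "eventually (\<lambda>x. (- 1) ^ n * f x < (- 1) ^ n * f (a n)) at_top"
        using a(2)[of n] by (intro order_tendstoD) auto
      moreover have "eventually (\<lambda>x. x > a n) at_top" by simp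
      ultimately have "eventually (\<lambda>x. (- 1) ^ n * f x < (- 1) ^ n * f (a n) \<and> x > a n) at_top" by (rule eventually_conj)
      then obtain x where x: "(- 1) ^ n * f x < (- 1) ^ n * f (a n)" "x > a n"
        by (metis (mono_tags, lifting) eventually_at_top_linorder order_refl)
      then obtain z where z: "a n < z" "z < x" "f x - f (a n) = (x - a n) * f' z" using mvt by blast
      have "0 < (- 1) ^ i * (f x - f (a n))" using x 3 by (simp add: algebra_simps)
      then have "0 < (x - a n) * ((- 1) ^ i * f' z)" unfolding z(3) by (simp add: algebra_simps)
      then have "0 < (- 1) ^ i * f' z" using x by (metis diff_gt_0_iff_gt zero_less_mult_pos)
      then show ?thesis using z 3 by (intro exI[of _ z]) auto
    qed
  qed
  then obtain b where b: "\<And>i. i \<le> Suc n \<Longrightarrow>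
      (i = 0 \<or> a (i - 1) < b i) \<and> (i \<le> n \<longrightarrow> b i < a i) \<and> (- 1) ^ i * f' (b i) > 0"
    by metis
  have "b i < b (Suc i)" if "i < Suc n" for i
    using b[of i] b[of "Suc i"] that by auto
  with b show ?thesis unfolding alternates_def by (intro exI[of _ b]) auto
qed

text \<open>Starting from the positive density, each differentiation adds one alternation. The
  \<open>n\<close>-th derivative is \<open>(- 1) ^ n\<close> times the Hermite polynomial times the
  density, and the density does not affect signs.\<close>

lemma alternates_hermite:
  "alternates n (\<lambda>x. (- 1) ^ n * poly (hermite n) x)"
proof -
  have "alternates n (\<lambda>x. (- 1) ^ n * (poly (hermite n) x * std_normal_density x))"
  proof (induction n)
    case 0
    then show ?case by (auto simp: alternates_def normal_density_pos)
  next
    case (Suc n)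
    have "((\<lambda>x. (- 1) ^ n * (poly (hermite n) x * std_normal_density x)) has_real_derivative
        (- 1) ^ Suc n * (poly (hermite (Suc n)) x * std_normal_density x)) (at x)" for x
      using DERIV_cmult[OF hermite_density_deriv[of n 0 x], of "(- 1) ^ n"] by simp
    moreover have "((\<lambda>x. (- 1) ^ n * (poly (hermite n) x * std_normal_density x)) \<longlongrightarrow> 0) at_top"
      using tendsto_mult[OF tendsto_const tendsto_poly_exp_0, of "(- 1) ^ n" "hermite n"] by simp
    moreover have "((\<lambda>x. (- 1) ^ n * (poly (hermite n) x * std_normal_density x)) \<longlongrightarrow> 0) at_bot"
      using tendsto_mult[OF tendsto_const tendsto_poly_exp_0_bot, of "(- 1) ^ n" "hermite n"] by simp
    ultimately show ?case by (intro alternates_deriv[OF Suc.IH])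
  qed
  moreover have "0 < c * (e * (y * std_normal_density x)) \<longleftrightarrow> 0 < c * (e * y)" for c e x y :: real
    using normal_density_pos[of 1 0 x] zero_less_mult_iff[of "c * (e * y)" "std_normal_density x"]
    by (simp add: mult.assoc)
  ultimately show ?thesis
    unfolding alternates_def by simp
qed

text \<open>The \<open>n\<close> sign changes give real zeros in disjoint intervals; with degree at
  most \<open>n\<close> these exhaust the complex zeros.\<close>

lemma alternates_imp_real_rooted:
  fixes p :: "real poly"
  assumes "alternates n (poly p)" "degree p \<le> n"
  shows "real_rooted p"
proof -
  obtain a where a: "\<And>i. i < n \<Longrightarrow> a i < a (Suc i)" "\<And>i. i \<le> n \<Longrightarrow> (- 1) ^ i * poly p (a i) > 0"
    using assms by (auto simp: alternates_def)
  have "\<exists>z. a i < z \<and> z < a (Suc i) \<and> poly p z = 0" if "i < n" for i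
  proof -
    have "poly p (a i) * poly p (a (Suc i)) < 0"
      using a(2)[of i] a(2)[of "Suc i"] that
      by (cases "even i") (auto simp: mult_less_0_iff)
    from poly_IVT[OF a(1)[OF that] this] show ?thesis by blast
  qed
  then obtain z where z: "\<And>i. i < n \<Longrightarrow> a i < z i" "\<And>i. i < n \<Longrightarrow> z i < a (Suc i)" "\<And>i. i < n \<Longrightarrow> poly p (z i) = 0"
    by metis
  have amono: "a i \<le> a j" if "i \<le> j" "j \<le> n" for i j
    using that by (induction j rule: dec_induct) (auto dest!: a(1) simp: Suc_le_eq intro: less_imp_le order_trans)
  have zmono: "z i < z j" if "i < j" "j < n" for i j
    using z(2)[of i] z(1)[of j] amono[of "Suc i" j] that by auto
  define R where "R = (\<lambda>i. complex_of_real (z i)) ` {..<n}"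
  define P where "P = map_poly complex_of_real p"
  have "inj_on (\<lambda>i. complex_of_real (z i)) {..<n}"
    by (rule inj_onI) (metis lessThan_iff linorder_neqE_nat of_real_eq_iff order_less_irrefl zmono)
  then have cardR: "card R = n" by (simp add: R_def card_image)
  have "p \<noteq> 0" using a(2)[of 0] by auto
  then have P0: "P \<noteq> 0" by (simp add: P_def map_poly_eq_0_iff)
  have degP: "degree P \<le> n" using assms(2) map_poly_degree_leq[of complex_of_real p] by (simp add: P_def)
  have "poly P (of_real x) = of_real (poly p x)" for x
    unfolding P_def by (induction p) (auto simp: map_poly_pCons)
  then have sub: "R \<subseteq> {w. poly P w = 0}"
    using z(3) by (auto simp: R_def)
  have "card {w. poly P w = 0} \<le> card R"
    using card_poly_roots_bound[OF P0] degP cardR by linarith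
  then have "R = {w. poly P w = 0}"
    using sub poly_roots_finite[OF P0] by (metis card_seteq)
  moreover have "w \<in> \<real>" if "w \<in> R" for w using that by (auto simp: R_def)
  ultimately show ?thesis by (auto simp: real_rooted_def P_def)
qed

section \<open>Gaussian binomial coefficients\<close>

text \<open>Given by the \<open>q\<close>-Pascal rule in any commutative ring: one recursion serves
  the polynomial variable, the value 1, and \<open>cis x\<close>, where the quotient of
  \<open>q\<close>-factorials can become 0 / 0.\<close>

fun qbinom :: "'a::comm_ring_1 \<Rightarrow> nat \<Rightarrow> nat \<Rightarrow> 'a" where
  "qbinom q n 0 = 1"
| "qbinom q 0 (Suc k) = 0"
| "qbinom q (Suc n) (Suc k) = qbinom q n k + q ^ Suc k * qbinom q n (Suc k)"

lemma qbinom_eq_0: "n < k \<Longrightarrow> qbinom q n k = 0"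
  by (induction q n k rule: qbinom.induct) auto

lemma qbinom_1: "qbinom 1 n k = of_nat (n choose k)"
proof (induction n arbitrary: k)
  case 0
  show ?case by (cases k) auto
next
  case (Suc n)
  show ?case by (cases k) (simp_all add: Suc.IH)
qed

lemma norm_qbinom_le:
  fixes q :: "'a::{real_normed_algebra_1,comm_ring_1}"
  assumes "norm q \<le> 1"
  shows "norm (qbinom q n k) \<le> real (n choose k)"
  using assms
proof (induction q n k rule: qbinom.induct)
  case (3 q n k)
  have "norm (q ^ Suc k) \<le> 1"
    using 3(3) by (metis norm_ge_zero norm_power_ineq order_trans power_le_one)
  then have "norm (q ^ Suc k * qbinom q n (Suc k)) \<le> 1 * real (n choose Suc k)"
    using 3 by (intro order_trans[OF norm_mult_ineq] mult_mono) auto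
  then show ?case
    using 3 norm_triangle_ineq[of "qbinom q n k" "q ^ Suc k * qbinom q n (Suc k)"]
    by (simp del: power_Suc)
qed auto

lemma poly_qbinom: "poly (qbinom p n k) x = qbinom (poly p x) n k"
  by (induction p n k rule: qbinom.induct) (auto simp: poly_power)

text \<open>The product formula in a form free of division. The \<open>q\<close>-Pascal rule leads
  from \<open>(a, b)\<close> to \<open>(a, b - 1)\<close> and \<open>(a - 1, b)\<close>, hence the
  induction on \<open>a + b\<close>.\<close>

lemma qbinom_prod:
  "qbinom q (a + b) b * (\<Prod>j<b. 1 - q ^ Suc j) = (\<Prod>j<b. 1 - q ^ (a + Suc j))"
proof (induction "a + b" arbitrary: a b)
  case (Suc n)
  show ?case
  proof (cases b)
    case b: (Suc b')
    define R where "R = (\<Prod>j<b'. 1 - q ^ (a + Suc j))"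
    have R: "qbinom q (a + b') b' * (\<Prod>j<b'. 1 - q ^ Suc j) = R"
      using Suc.hyps(1)[of a b'] Suc.hyps(2) b by (simp add: R_def)
    have S: "qbinom q (a + b') (Suc b') * (\<Prod>j<Suc b'. 1 - q ^ Suc j) = (1 - q ^ a) * R"
    proof (cases a)
      case 0
      then show ?thesis by (simp add: qbinom_eq_0)
    next
      case (Suc a')
      have "qbinom q (a' + Suc b') (Suc b') * (\<Prod>j<Suc b'. 1 - q ^ Suc j)
          = (\<Prod>j<Suc b'. 1 - q ^ (a' + Suc j))"
        using Suc.hyps(1)[of a' "Suc b'"] Suc.hyps(2) b Suc by simp
      also have "\<dots> = (1 - q ^ a) * R"
        unfolding R_def Suc by (subst prod.lessThan_Suc_shift) simp
      finally show ?thesis using Suc by simp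
    qed
    have "qbinom q (a + b) b * (\<Prod>j<b. 1 - q ^ Suc j)
       = (qbinom q (a + b') b' * (\<Prod>j<b'. 1 - q ^ Suc j)) * (1 - q ^ b)
         + q ^ b * (qbinom q (a + b') (Suc b') * (\<Prod>j<Suc b'. 1 - q ^ Suc j))"
      unfolding b by (simp add: algebra_simps)
    also have "\<dots> = R * (1 - q ^ (a + b))"
      unfolding R S by (simp add: algebra_simps power_add)
    also have "\<dots> = (\<Prod>j<b. 1 - q ^ (a + Suc j))"
      by (simp add: b R_def)
    finally show ?thesis .
  qed simp
qed simp

text \<open>Splitting off the factor \<open>j = 0\<close> replaces \<open>z\<close> by
  \<open>z * q\<close> in the remaining product. Keeping the summand \<open>b\<close> general gives
  the homogeneous form, which also makes sense for weight 0, that is for an empty part.\<close>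

lemma qbinomial_theorem:
  fixes q z b :: "'a::comm_ring_1"
  shows "(\<Prod>j<n. b + z * q ^ j) = (\<Sum>k\<le>n. q ^ (k choose 2) * qbinom q n k * b ^ (n - k) * z ^ k)"
proof (induction n arbitrary: z)
  case (Suc n)
  have c0: "0 choose 2 = 0" by (simp add: numeral_2_eq_2)
  define c where "c = (\<lambda>k. q ^ (k choose 2) * q ^ k * qbinom q n k * b ^ (n - k) * z ^ k)"
  have "(\<Prod>j<Suc n. b + z * q ^ j) = (b + z) * (\<Prod>j<n. b + z * q * q ^ j)"
    by (subst prod.lessThan_Suc_shift) (simp add: mult_ac)
  also have "(\<Prod>j<n. b + z * q * q ^ j) = (\<Sum>k\<le>n. c k)"
    by (subst Suc.IH) (simp add: c_def power_mult_distrib mult_ac)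
  also have "(b + z) * \<dots> = b * (\<Sum>k\<le>n. c k) + z * (\<Sum>k\<le>n. c k)" by (simp add: algebra_simps)
  also have "b * (\<Sum>k\<le>n. c k) = (\<Sum>k\<le>Suc n. q ^ (k choose 2) * q ^ k * qbinom q n k * b ^ (Suc n - k) * z ^ k)"
    by (auto simp: c_def sum_distrib_left qbinom_eq_0 Suc_diff_le mult_ac intro!: sum.cong)
  also have "\<dots> = b ^ Suc n + (\<Sum>k\<le>n. q ^ (Suc k choose 2) * q ^ Suc k * qbinom q n (Suc k) * b ^ (n - k) * z ^ Suc k)"
    by (subst sum.atMost_Suc_shift) (simp add: c0)
  also have "z * (\<Sum>k\<le>n. c k) = (\<Sum>k\<le>n. q ^ (Suc k choose 2) * qbinom q n k * b ^ (n - k) * z ^ Suc k)"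
    by (auto simp: c_def sum_distrib_left numeral_2_eq_2 power_add mult_ac intro!: sum.cong)
  finally have "(\<Prod>j<Suc n. b + z * q ^ j) = b ^ Suc n +
     (\<Sum>k\<le>n. q ^ (Suc k choose 2) * qbinom q (Suc n) (Suc k) * b ^ (n - k) * z ^ Suc k)"
    by (simp add: sum.distrib[symmetric] algebra_simps)
  also have "\<dots> = (\<Sum>k\<le>Suc n. q ^ (k choose 2) * qbinom q (Suc n) k * b ^ (Suc n - k) * z ^ k)"
    by (subst sum.atMost_Suc_shift) (simp add: c0)
  finally show ?case .
qed (simp add: numeral_2_eq_2)

text \<open>With \<open>n = a + b\<close>, consecutive terms in the expansion of
  \<open>(b + a) ^ n\<close> have ratio \<open>(n - j) * b / ((j + 1) * a)\<close>; they rise up to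
  index \<open>b\<close> and fall after it, so the term at \<open>b\<close> is the largest of
  \<open>n + 1\<close>.\<close>

lemma binomial_max_term:
  "real (a + b) ^ (a + b) \<le> real (a + b + 1) * (real (a + b choose b) * real a ^ a * real b ^ b)"
proof -
  define n where "n = a + b"
  define t where "t = (\<lambda>j. (n choose j) * b ^ j * a ^ (n - j))"
  have step: "t (Suc j) * (Suc j * a) = t j * ((n - j) * b)" if "j < n" for j
  proof -
    have "(n choose Suc j) * Suc j = (n choose j) * (n - j)"
      using binomial_absorb_comp[of n j] binomial_absorption[of j n] by (simp only: mult.commute)
    moreover have "a ^ (n - j) = a * a ^ (n - Suc j)"
      using that by (metis Suc_diff_Suc power_Suc)
    ultimately have "((n choose Suc j) * Suc j) * (b ^ j * b) * (a * a ^ (n - Suc j))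
        = ((n choose j) * (n - j)) * (b ^ j * b) * a ^ (n - j)" by simp
    then show ?thesis unfolding t_def by (simp only: power_Suc mult_ac)
  qed
  have up: "t j \<le> t (Suc j)" if jb: "j < b" for j
  proof (cases "a = 0")
    case False
    have "t j * (Suc j * a) \<le> t j * ((n - j) * b)"
    proof (intro mult_left_mono)
      obtain c where "b = Suc (j + c)" using less_imp_Suc_add[OF jb] by blast
      then have "n - j = a + Suc c" "b = Suc j + c" by (simp_all add: n_def)
      then show "Suc j * a \<le> (n - j) * b" by (simp add: algebra_simps)
    qed auto
    also have "\<dots> = t (Suc j) * (Suc j * a)" using step[of j] that by (simp add: n_def)
    finally show ?thesis using False by (simp only: mult_le_cancel2) simp
  next
    case True
    \<comment> \<open>Here \<open>b = n\<close>, and \<open>t j\<close> vanishes because it contains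
      a positive power of 0.\<close>
    then have "n - j = Suc (b - Suc j)" using that by (simp add: n_def)
    then show ?thesis using True by (simp add: t_def)
  qed
  have down: "t (Suc j) \<le> t j" if "b \<le> j" for j
  proof (cases "j < n")
    case True
    then have "a > 0" using that by (simp add: n_def)
    have "t (Suc j) * (Suc j * a) = t j * ((n - j) * b)" by (rule step[OF True])
    also have "\<dots> \<le> t j * (Suc j * a)"
    proof (intro mult_left_mono)
      have "(n - j) * b \<le> a * Suc j"
        using that by (intro mult_mono) (auto simp: n_def)
      then show "(n - j) * b \<le> Suc j * a" by (simp add: mult.commute)
    qed auto
    finally show ?thesis using \<open>a > 0\<close> by (simp only: mult_le_cancel2) simp
  qed (auto simp: t_def binomial_eq_0)
  have le1: "t j \<le> t b" if "j \<le> b" for j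
    using that
  proof (induction j rule: inc_induct)
    case (step i)
    then show ?case using up[of i] by linarith
  qed simp
  have le2: "t j \<le> t b" if "b \<le> j" for j
    using that
  proof (induction j rule: dec_induct)
    case (step i)
    then show ?case using down[of i] by linarith
  qed simp
  have "(b + a) ^ n = (\<Sum>j\<le>n. t j)" unfolding t_def binomial by simp
  also have "\<dots> \<le> (\<Sum>j\<le>n. t b)" using le1 le2 by (intro sum_mono) (metis nat_le_linear)
  also have "\<dots> = (n + 1) * t b" by simp
  finally have "real ((b + a) ^ n) \<le> real ((n + 1) * t b)" by (simp only: of_nat_le_iff)
  then show ?thesis by (simp add: t_def n_def algebra_simps)
qed


section \<open>Evaluating real polynomials at complex points\<close>

definition cpoly :: "real poly \<Rightarrow> complex \<Rightarrow> complex" where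
  "cpoly p z = poly (map_poly of_real p) z"

lemma cpoly_altdef: "degree p \<le> n \<Longrightarrow> cpoly p z = (\<Sum>i\<le>n. of_real (coeff p i) * z ^ i)"
  using degree_map_poly[of complex_of_real p]
  by (auto simp: cpoly_def poly_altdef coeff_map_poly coeff_eq_0 intro!: sum.mono_neutral_cong_left le_degree)

lemma cpoly_add: "cpoly (p + q) z = cpoly p z + cpoly q z"
  by (simp add: cpoly_altdef[of _ "max (degree p) (degree q)"] degree_add_le sum.distrib algebra_simps)

lemma cpoly_pCons: "cpoly (pCons a p) z = of_real a + z * cpoly p z"
  by (simp add: cpoly_def map_poly_pCons)

lemma cpoly_0 [simp]: "cpoly 0 z = 0" and cpoly_1 [simp]: "cpoly 1 z = 1"
  by (simp_all add: cpoly_def)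

lemma cpoly_smult: "cpoly (smult c p) z = of_real c * cpoly p z"
  by (induction p) (auto simp: cpoly_pCons algebra_simps)

lemma cpoly_mult: "cpoly (p * q) z = cpoly p z * cpoly q z"
  by (induction p) (auto simp: cpoly_pCons cpoly_add cpoly_smult algebra_simps)

lemma cpoly_power: "cpoly (p ^ n) z = cpoly p z ^ n"
  by (induction n) (auto simp: cpoly_mult)

lemma cpoly_qbinom: "cpoly (qbinom p n k) z = qbinom (cpoly p z) n k"
  by (induction p n k rule: qbinom.induct) (auto simp: cpoly_add cpoly_mult cpoly_power)


section \<open>Factorisation of the multinomial into Gaussian binomials\<close>

lemma qpoch_add: "qpoch (a + b) = qpoch a * (\<Prod>j<b. 1 - [:0, 1:] ^ (a + Suc j))"
  by (induction b) (auto simp: qpoch_Suc monom_altdef mult_ac)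

lemma qmultinomial_0: "qmultinomial 0 ns = 1"
  by (simp add: qmultinomial_def)

text \<open>Exactness of the division, for \<open>r\<close> and for \<open>r + 1\<close>, turns the
  claim into an identity of products, from which the nonzero product of all
  \<open>qpoch (ns i)\<close> is cancelled.\<close>

lemma qmultinomial_Suc:
  "qmultinomial (Suc r) ns = qmultinomial r ns * qbinom [:0, 1:] ((\<Sum>i=1..r. ns i) + ns (Suc r)) (ns (Suc r))"
proof -
  define N b where "N = (\<Sum>i=1..r. ns i)" and "b = ns (Suc r)"
  have "qbinom [:0, 1:] (N + b) b * qpoch b = (\<Prod>j<b. 1 - [:0, 1::real:] ^ (N + Suc j))"
    using qpoch_add[of 0 b] qbinom_prod[of "[:0, 1::real:]" N b] by simp
  then have "qpoch (N + b) = qpoch N * (qbinom [:0, 1:] (N + b) b * qpoch b)"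
    by (simp only: qpoch_add)
  also have "qpoch N = qmultinomial r ns * (\<Prod>i=1..r. qpoch (ns i))"
    using qmultinomial_exact[of r ns] by (simp add: N_def)
  finally have "qpoch (N + b) = qmultinomial r ns * qbinom [:0, 1:] (N + b) b * (\<Prod>i=1..Suc r. qpoch (ns i))"
    by (simp add: b_def mult_ac)
  moreover have "qpoch (N + b) = qmultinomial (Suc r) ns * (\<Prod>i=1..Suc r. qpoch (ns i))"
    using qmultinomial_exact[of "Suc r" ns] by (simp add: N_def b_def)
  moreover have "(\<Prod>i=1..Suc r. qpoch (ns i)) \<noteq> 0" by (simp add: qpoch_nonzero)
  ultimately show ?thesis by (metis N_def b_def mult_right_cancel)
qed

section \<open>Gaussian binomial coefficients on the unit circle\<close>

lemma has_bochner_integral_cis: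
  "has_bochner_integral lborel (\<lambda>x. indicator {- pi..pi} x *\<^sub>R cis (of_int m * x))
     (if m = 0 then 2 * pi else 0)"
proof (cases "m = 0")
  case True
  have "(complex_of_real has_vector_derivative 1) (at x within {- pi..pi})" for x
    using has_vector_derivative_real_field[of "\<lambda>z. z" 1 x "{- pi..pi}"] by simp
  then have "has_bochner_integral lborel (\<lambda>x. indicator {- pi..pi} x *\<^sub>R (1::complex))
      (complex_of_real pi - complex_of_real (- pi))"
    by (intro has_bochner_integral_FTC_Icc) auto
  then show ?thesis by (simp add: True)
next
  case False
  define F where "F = (\<lambda>z. exp (\<i> * (of_int m * z)) / (\<i> * of_int m))"
  have D: "((\<lambda>x. F (of_real x)) has_vector_derivative cis (of_int m * x)) (at x within {- pi..pi})" for x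
  proof (rule has_vector_derivative_real_field)
    show "(F has_field_derivative cis (of_int m * x)) (at (of_real x))"
      unfolding F_def using False
      by (auto intro!: derivative_eq_intros simp: cis_conv_exp mult_ac)
  qed
  have "continuous_on {- pi..pi} (\<lambda>x. cis (of_int m * x))"
    by (intro continuous_intros)
  from has_bochner_integral_FTC_Icc[OF _ D this]
  have "has_bochner_integral lborel (\<lambda>x. indicator {- pi..pi} x *\<^sub>R cis (of_int m * x))
     (F (of_real pi) - F (of_real (- pi)))" by simp
  also have "F (of_real pi) - F (of_real (- pi)) = 0"
  proof -
    have "exp (\<i> * (of_int m * of_real pi)) = exp (\<i> * (of_int m * of_real (- pi)))"
      by (subst exp_eq) (auto intro!: exI[of _ m] simp: algebra_simps)
    then show ?thesis unfolding F_def by simp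
  qed
  finally show ?thesis using False by simp
qed

lemma has_bochner_integral_fourier_coeff:
  fixes a :: "nat \<Rightarrow> complex"
  shows "has_bochner_integral lborel
     (\<lambda>x. indicator {- pi..pi} x *\<^sub>R ((\<Sum>k\<le>n. a k * cis x ^ k) * cis (- of_int m * x)))
     (2 * pi * (if 0 \<le> m \<and> m \<le> int n then a (nat m) else 0))"
proof -
  have "has_bochner_integral lborel
     (\<lambda>x. \<Sum>k\<le>n. a k * (indicator {- pi..pi} x *\<^sub>R cis (of_int (int k - m) * x)))
     (\<Sum>k\<le>n. a k * complex_of_real (if int k - m = 0 then 2 * pi else 0))"
    by (intro has_bochner_integral_sum has_bochner_integral_mult_right has_bochner_integral_cis)
  also have "(\<Sum>k\<le>n. a k * complex_of_real (if int k - m = 0 then 2 * pi else 0)) =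
     (\<Sum>k\<le>n. if k = nat m then (if 0 \<le> m then a k * (2 * pi) else 0) else 0)"
    by (intro sum.cong) (auto split: if_splits)
  also have "\<dots> = 2 * pi * (if 0 \<le> m \<and> m \<le> int n then a (nat m) else 0)"
    by (subst sum.delta) (auto simp: nat_le_iff)
  also have "(\<lambda>x. \<Sum>k\<le>n. a k * (indicator {- pi..pi} x *\<^sub>R cis (of_int (int k - m) * x))) =
     (\<lambda>x. indicator {- pi..pi} x *\<^sub>R ((\<Sum>k\<le>n. a k * cis x ^ k) * cis (- of_int m * x)))"
  proof
    fix x
    have "cis (of_int (int k - m) * x) = cis x ^ k * cis (- of_int m * x)" for k
      by (simp add: Complex.DeMoivre cis_mult algebra_simps)
    then show "(\<Sum>k\<le>n. a k * (indicator {- pi..pi} x *\<^sub>R cis (of_int (int k - m) * x))) =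
        indicator {- pi..pi} x *\<^sub>R ((\<Sum>k\<le>n. a k * cis x ^ k) * cis (- of_int m * x))"
      by (simp add: sum_distrib_right scaleR_sum_right mult.assoc)
  qed
  finally show ?thesis .
qed

text \<open>A coefficient is the mean over the unit circle of the polynomial times
  \<open>cis (- k * x)\<close>, hence at most any bound valid on the circle.\<close>

lemma norm_coeff_le:
  fixes a :: "nat \<Rightarrow> complex"
  assumes "\<And>x. norm (\<Sum>k\<le>n. a k * cis x ^ k) \<le> B" "k \<le> n"
  shows "norm (a k) \<le> B"
proof -
  have B: "B \<ge> 0" using assms(1)[of 0] norm_ge_zero order_trans by blast
  let ?f = "\<lambda>x. indicator {- pi..pi} x *\<^sub>R ((\<Sum>k\<le>n. a k * cis x ^ k) * cis (- of_int (int k) * x))"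
  have *: "has_bochner_integral lborel ?f (2 * pi * a k)"
    using has_bochner_integral_fourier_coeff[of a n "int k"] assms(2) by simp
  have **: "has_bochner_integral lborel (\<lambda>x. indicator {- pi..pi} x *\<^sub>R B) (2 * pi * B)"
    by (auto simp: has_bochner_integral_iff)
  have "norm (2 * pi * a k) \<le> 2 * pi * B"
  proof -
    have "norm (integral\<^sup>L lborel ?f) \<le> integral\<^sup>L lborel (\<lambda>x. indicator {- pi..pi} x *\<^sub>R B)"
    proof (rule Bochner_Integration.integral_norm_bound_integral)
      show "norm (?f x) \<le> indicator {- pi..pi} x *\<^sub>R B" for x
        using assms(1)[of x] by (simp add: norm_mult split: split_indicator)
    qed (use * ** in \<open>simp_all only: has_bochner_integral_iff\<close>)
    then show ?thesis
      by (simp only: has_bochner_integral_integral_eq[OF *] has_bochner_integral_integral_eq[OF **])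
  qed
  then show ?thesis by (simp add: norm_mult)
qed

section \<open>Frequencies of at least 2 * pi / n\<close>

lemma sin_minus_x_cos_nonneg:
  assumes "0 \<le> x" "x \<le> pi" shows "0 \<le> sin x - x * cos x" 
proof -
  have "sin 0 - 0 * cos 0 \<le> sin x - x * cos x"
  proof (rule DERIV_nonneg_imp_nondecreasing[OF assms(1)])
    fix y assume y: "0 \<le> y" "y \<le> x"
    have "((\<lambda>x. sin x - x * cos x) has_real_derivative y * sin y) (at y)"
      by (auto intro!: derivative_eq_intros)
    moreover have "0 \<le> y * sin y" using y assms by (auto intro!: mult_nonneg_nonneg sin_ge_zero)
    ultimately show "\<exists>z. ((\<lambda>x. sin x - x * cos x) has_real_derivative z) (at y) \<and> 0 \<le> z" by blast
  qed
  then show ?thesis by simp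
qed

text \<open>Jordan's inequality: \<open>sin x / x\<close> decreases up to \<open>pi / 2\<close>, as
  the numerator of its derivative is \<open>x * cos x - sin x\<close>.\<close>

lemma sin_ge_jordan:
  assumes "0 \<le> x" "x \<le> pi / 2" shows "2 / pi * x \<le> sin x"
proof (cases "x = 0")
  case False
  have "sin (pi / 2) / (pi / 2) \<le> sin x / x"
  proof (rule DERIV_nonpos_imp_nonincreasing[OF assms(2)])
    fix y assume y: "x \<le> y" "y \<le> pi / 2"
    then have "y > 0" using assms False by auto
    then have "((\<lambda>x. sin x / x) has_real_derivative (cos y * y - sin y) / (y * y)) (at y)"
      by (auto intro!: derivative_eq_intros)
    moreover have "(cos y * y - sin y) / (y * y) \<le> 0"
      using sin_minus_x_cos_nonneg[of y] y \<open>y > 0\<close>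
      by (intro divide_nonpos_nonneg) (auto simp: mult.commute)
    ultimately show "\<exists>z. ((\<lambda>x. sin x / x) has_real_derivative z) (at y) \<and> z \<le> 0" by blast
  qed
  then show ?thesis using False assms by (simp add: field_simps)
qed simp

lemma norm_cis_minus_1: "norm (cis x - 1) = 2 * \<bar>sin (x / 2)\<bar>"
proof -
  have "(norm (cis x - 1))\<^sup>2 = (2 * \<bar>sin (x / 2)\<bar>)\<^sup>2"
  proof -
    have "(norm (cis x - 1))\<^sup>2 = (cos x - 1)\<^sup>2 + (sin x)\<^sup>2" by (simp add: cmod_power2)
    also have "\<dots> = 2 - 2 * cos x"
      using sin_cos_squared_add[of x] by (simp add: power2_eq_square algebra_simps)
    also have "\<dots> = (2 * \<bar>sin (x / 2)\<bar>)\<^sup>2"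
      using cos_double_sin[of "x / 2"] by (simp add: power_mult_distrib)
    finally show ?thesis .
  qed
  then show ?thesis by (subst (asm) power2_eq_iff_nonneg) auto
qed

text \<open>The geometric sum has modulus at most \<open>2 / norm (cis x - 1)\<close>, which by
  Jordan's inequality is at most \<open>pi / \<bar>x\<bar>\<close>. The threshold
  \<open>2 * pi / n\<close> is what turns this into \<open>n / 2\<close>.\<close>

lemma sum_cos_arith_le:
  assumes "2 * pi / real n \<le> \<bar>x\<bar>" "\<bar>x\<bar> \<le> pi" "n > 0"
  shows "(\<Sum>j<n. cos (y + real j * x)) \<le> real n / 2"
proof -
  have "2 * pi / real n > 0" using assms by simp
  then have x: "x \<noteq> 0" using assms by linarith
  have "2 / pi * \<bar>x / 2\<bar> \<le> sin \<bar>x / 2\<bar>"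
    using assms by (intro sin_ge_jordan) auto
  then have ge: "2 / pi * \<bar>x\<bar> \<le> norm (cis x - 1)"
    unfolding norm_cis_minus_1 by (simp add: abs_if split: if_splits)
  have ne: "cis x \<noteq> 1"
  proof
    assume "cis x = 1"
    moreover have "0 < 2 / pi * \<bar>x\<bar>" using x by simp
    ultimately show False using ge by simp
  qed
  have "(\<Sum>j<n. cos (y + real j * x)) = Re (\<Sum>j<n. cis y * cis x ^ j)"
    by (simp add: Complex.DeMoivre cis_mult)
  also have "\<dots> \<le> norm (\<Sum>j<n. cis y * cis x ^ j)" by (rule complex_Re_le_cmod)
  also have "\<dots> = norm (1 - cis x ^ n) / norm (cis x - 1)"
    unfolding sum_distrib_left[symmetric] sum_gp_strict using ne
    by (simp add: norm_mult norm_divide norm_minus_commute)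
  also have "\<dots> \<le> 2 / (2 / pi * \<bar>x\<bar>)"
    using ge x norm_triangle_ineq4[of 1 "cis x ^ n"] by (intro frac_le) (auto simp: norm_power)
  also have "\<dots> \<le> real n / 2"
    using assms x by (simp add: field_simps)
  finally show ?thesis .
qed

text \<open>The squared modulus is \<open>(a + b)\<^sup>2 * (1 - 2 * \<kappa> * (1 - cos t))\<close>
  with \<open>\<kappa> = a * b / (a + b)\<^sup>2\<close>; then \<open>1 + y \<le> exp y\<close>. The
  exponent is linear in \<open>cos t\<close>, so a product of such bounds only involves a sum of
  cosines.\<close>

lemma norm_add_cis_le:
  assumes "a \<ge> 0" "b \<ge> 0" "a + b > 0"
  shows "norm (of_real a + of_real b * cis t) \<le> (a + b) * exp (- (a * b / (a + b)\<^sup>2) * (1 - cos t))"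
proof (rule power2_le_imp_le)
  have "(norm (of_real a + of_real b * cis t))\<^sup>2 = (a + b * cos t)\<^sup>2 + (b * sin t)\<^sup>2"
    by (simp add: cmod_power2)
  also have "\<dots> = a\<^sup>2 + 2 * a * b * cos t + b\<^sup>2"
    by (simp add: power_mult_distrib sin_squared_eq) (simp add: power2_eq_square algebra_simps)
  also have "\<dots> = (a + b)\<^sup>2 * (1 + (- 2 * (a * b / (a + b)\<^sup>2) * (1 - cos t)))"
  proof -
    have "(a + b)\<^sup>2 * (a * b / (a + b)\<^sup>2) = a * b" using assms by simp
    moreover have "(a + b)\<^sup>2 * (1 + (- 2 * k * (1 - cos t))) = (a + b)\<^sup>2 - 2 * ((a + b)\<^sup>2 * k) * (1 - cos t)" for k
      by (simp add: algebra_simps)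
    ultimately show ?thesis by (simp only:) (simp add: power2_eq_square algebra_simps)
  qed
  also have "\<dots> \<le> (a + b)\<^sup>2 * exp (- 2 * (a * b / (a + b)\<^sup>2) * (1 - cos t))"
    by (intro mult_left_mono exp_ge_add_one_self) auto
  also have "\<dots> = ((a + b) * exp (- (a * b / (a + b)\<^sup>2) * (1 - cos t)))\<^sup>2"
    by (simp add: power_mult_distrib exp_double[symmetric])
  finally show "(norm (of_real a + of_real b * cis t))\<^sup>2
     \<le> ((a + b) * exp (- (a * b / (a + b)\<^sup>2) * (1 - cos t)))\<^sup>2" .
qed (use assms in auto)

text \<open>Cauchy's estimate for \<open>\<Prod>j<n. a + b * z * q ^ j\<close> on \<open>\<bar>z\<bar> = 1\<close>. The weights \<open>a\<close> and \<open>b\<close> are chosen so that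
  for \<open>q = 1\<close> the coefficient in question is the largest of the \<open>n + 1\<close> coefficients, which sum to \<open>n ^ n\<close>.\<close>

lemma norm_qbinom_cis_le:
  assumes "2 * pi / real (a + b) \<le> \<bar>x\<bar>" "\<bar>x\<bar> \<le> pi" "a + b > 0"
  shows "norm (qbinom (cis x) (a + b) b)
      \<le> real (a + b + 1) * real (a + b choose b) * exp (- (real a * real b / (2 * real (a + b))))"
proof -
  define n where "n = a + b"
  define \<kappa> where "\<kappa> = real a * real b / (real a + real b)\<^sup>2"
  define A where "A = (\<lambda>k. cis x ^ (k choose 2) * qbinom (cis x) n k * of_real (real a) ^ (n - k) * of_real (real b) ^ k)"
  have n: "real a + real b = real n" "n > 0" using assms by (auto simp: n_def)
  have shift: "cis y * cis x ^ j = cis (y + real j * x)" for y j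
    by (simp add: Complex.DeMoivre cis_mult)
  have "norm (\<Sum>k\<le>n. A k * cis y ^ k) \<le> real n ^ n * exp (- \<kappa> * (n / 2))" for y
  proof -
    have "(\<Sum>k\<le>n. A k * cis y ^ k) = (\<Prod>j<n. of_real (real a) + of_real (real b) * cis y * cis x ^ j)"
      by (subst qbinomial_theorem) (simp add: A_def power_mult_distrib mult_ac)
    also have "norm \<dots> = (\<Prod>j<n. norm (of_real (real a) + of_real (real b) * cis (y + real j * x)))"
      by (simp add: prod_norm[symmetric] mult.assoc shift)
    also have "\<dots> \<le> (\<Prod>j<n. real n * exp (- \<kappa> * (1 - cos (y + real j * x))))"
      unfolding \<kappa>_def n(1)[symmetric] using n
      by (intro prod_mono conjI norm_ge_zero norm_add_cis_le) auto
    also have "\<dots> = real n ^ n * exp (- \<kappa> * (n - (\<Sum>j<n. cos (y + real j * x))))"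
      by (simp add: prod.distrib exp_sum[symmetric] sum_distrib_left[symmetric] sum_negf sum_subtractf)
    also have "\<dots> \<le> real n ^ n * exp (- \<kappa> * (n / 2))"
    proof -
      have "(\<Sum>j<n. cos (y + real j * x)) \<le> real n / 2"
        using assms by (intro sum_cos_arith_le) (auto simp: n_def)
      moreover have "\<kappa> \<ge> 0" by (simp add: \<kappa>_def)
      ultimately have "\<kappa> * (n / 2) \<le> \<kappa> * (n - (\<Sum>j<n. cos (y + real j * x)))"
        by (intro mult_left_mono) auto
      then show ?thesis by (intro mult_left_mono) auto
    qed
    finally show ?thesis .
  qed
  then have "norm (A b) \<le> real n ^ n * exp (- \<kappa> * (n / 2))"
    by (rule norm_coeff_le) (simp add: n_def)
  also have "norm (A b) = norm (qbinom (cis x) n b) * (real a ^ a * real b ^ b)"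
    by (simp add: A_def norm_mult norm_power n_def)
  also have "real n ^ n * exp (- \<kappa> * (n / 2)) \<le>
      (real (n + 1) * (real (n choose b) * real a ^ a * real b ^ b)) * exp (- \<kappa> * (n / 2))"
    using binomial_max_term[of a b] by (intro mult_right_mono) (auto simp: n_def)
  also have "\<dots> = (real (n + 1) * real (n choose b) * exp (- \<kappa> * (n / 2))) * (real a ^ a * real b ^ b)"
    by simp
  \<comment> \<open>The cancelled factor is positive even if \<open>a\<close> or \<open>b\<close> is
    0, since \<open>0 ^ 0 = 1\<close>.\<close>
  finally have "norm (qbinom (cis x) n b) \<le> real (n + 1) * real (n choose b) * exp (- \<kappa> * (n / 2))"
    by (rule mult_right_le_imp_le) (auto intro!: mult_pos_pos simp: zero_less_power_eq)
  also have "- \<kappa> * (n / 2) = - (real a * real b / (2 * real (a + b)))"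
    unfolding \<kappa>_def n(1) n_def[symmetric] using n(2) by (simp add: power2_eq_square)
  finally show ?thesis by (simp add: n_def)
qed

section \<open>Sine quotients with the quadratic term compensated\<close>

lemma sin_minus_x_cos_le:
  assumes "0 \<le> (x::real)" shows "sin x - x * cos x \<le> x ^ 3 / 3"
proof -
  have "0 ^ 3 / 3 - (sin 0 - 0 * cos 0) \<le> x ^ 3 / 3 - (sin x - x * cos x)"
  proof (rule DERIV_nonneg_imp_nondecreasing[OF assms])
    fix y :: real assume y: "0 \<le> y"
    have "((\<lambda>x. x ^ 3 / 3 - (sin x - x * cos x)) has_real_derivative y * (y - sin y)) (at y)"
      by (auto intro!: derivative_eq_intros simp: power2_eq_square algebra_simps)
    moreover have "0 \<le> y * (y - sin y)" using y sin_x_le_x[OF y] by simp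
    ultimately show "\<exists>z. ((\<lambda>x. x ^ 3 / 3 - (sin x - x * cos x)) has_real_derivative z) (at y) \<and> 0 \<le> z" by blast
  qed
  then show ?thesis by simp
qed

text \<open>The expression is \<open>- x\<^sup>2 * exp (- x\<^sup>2 / 6)\<close> times the
  derivative of \<open>sin x / x * exp (x\<^sup>2 / 6)\<close>. The exponential cancels the
  quadratic Taylor term of \<open>sin x / x\<close>, which leaves order
  \<open>x ^ 5\<close>.\<close>

lemma sin_taylor_gap_deriv:
  "((\<lambda>x::real. sin x - x * cos x - x\<^sup>2 * sin x / 3) has_real_derivative x / 3 * (sin x - x * cos x)) (at x)"
  by (auto intro!: derivative_eq_intros simp: power2_eq_square field_simps)

lemma sin_taylor_gap_nonneg:
  assumes "0 \<le> x" "x \<le> pi" shows "0 \<le> sin x - x * cos x - x\<^sup>2 * sin x / 3"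
proof -
  have "sin 0 - 0 * cos 0 - 0\<^sup>2 * sin 0 / 3 \<le> sin x - x * cos x - x\<^sup>2 * sin x / 3"
  proof (rule DERIV_nonneg_imp_nondecreasing[OF assms(1)])
    fix y :: real assume y: "0 \<le> y" "y \<le> x"
    then have "0 \<le> y / 3 * (sin y - y * cos y)"
      using sin_minus_x_cos_nonneg[of y] assms by simp
    then show "\<exists>z. ((\<lambda>x. sin x - x * cos x - x\<^sup>2 * sin x / 3) has_real_derivative z) (at y) \<and> 0 \<le> z"
      using sin_taylor_gap_deriv by blast
  qed
  then show ?thesis by simp
qed

lemma sin_taylor_gap_le:
  assumes "0 \<le> (x::real)" shows "sin x - x * cos x - x\<^sup>2 * sin x / 3 \<le> x ^ 5 / 45"
proof -
  have "0 ^ 5 / 45 - (sin 0 - 0 * cos 0 - 0\<^sup>2 * sin 0 / 3) \<le> x ^ 5 / 45 - (sin x - x * cos x - x\<^sup>2 * sin x / 3)"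
  proof (rule DERIV_nonneg_imp_nondecreasing[OF assms])
    fix y :: real assume y: "0 \<le> y"
    have "y / 3 * (sin y - y * cos y) \<le> y / 3 * (y ^ 3 / 3)"
      using y sin_minus_x_cos_le[OF y] by (intro mult_left_mono) auto
    then have "0 \<le> y ^ 4 / 9 - y / 3 * (sin y - y * cos y)"
      by (simp add: power3_eq_cube power4_eq_xxxx)
    moreover have "((\<lambda>x. x ^ 5 / 45) has_real_derivative y ^ 4 / 9) (at y)"
      by (auto intro!: derivative_eq_intros)
    ultimately show "\<exists>z. ((\<lambda>x. x ^ 5 / 45 - (sin x - x * cos x - x\<^sup>2 * sin x / 3)) has_real_derivative z) (at y) \<and> 0 \<le> z"
      using DERIV_diff[OF _ sin_taylor_gap_deriv] by blast
  qed
  then show ?thesis by simp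
qed

lemma sin_ratio_deriv:
  assumes "(x::real) > 0"
  shows "((\<lambda>x. sin x / x * exp (x\<^sup>2 / 6)) has_real_derivative
     - ((sin x - x * cos x - x\<^sup>2 * sin x / 3) / x\<^sup>2) * exp (x\<^sup>2 / 6)) (at x)"
  using assms by (auto intro!: derivative_eq_intros simp: power2_eq_square field_simps)

lemma sin_ratio_antimono:
  fixes x y :: real
  assumes "0 < x" "x \<le> y" "y < pi"
  shows "sin y / y * exp (y\<^sup>2 / 6) \<le> sin x / x * exp (x\<^sup>2 / 6)"
proof (rule DERIV_nonpos_imp_nonincreasing[OF assms(2)])
  fix z assume z: "x \<le> z" "z \<le> y"
  then have "z > 0" using assms by auto
  moreover have "- ((sin z - z * cos z - z\<^sup>2 * sin z / 3) / z\<^sup>2) * exp (z\<^sup>2 / 6) \<le> 0"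
    using sin_taylor_gap_nonneg[of z] z assms by (intro mult_nonpos_nonneg) (auto intro!: divide_nonneg_nonneg)
  ultimately show "\<exists>d. ((\<lambda>x. sin x / x * exp (x\<^sup>2 / 6)) has_real_derivative d) (at z) \<and> d \<le> 0"
    using sin_ratio_deriv by blast
qed

text \<open>The factor \<open>exp (x ^ 4)\<close> contributes \<open>4 * x ^ 4 * sin x\<close> to
  the numerator of the derivative, while the Taylor gap takes away at most
  \<open>x ^ 5 / 45\<close>. The power 4 is the natural one; the constant in the exponent is
  generous.\<close>

lemma sin_ratio_mono:
  fixes x y :: real
  assumes "0 < x" "x \<le> y" "y \<le> 1"
  shows "sin x / x * exp (x\<^sup>2 / 6) * exp (x ^ 4) \<le> sin y / y * exp (y\<^sup>2 / 6) * exp (y ^ 4)"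
proof (rule DERIV_nonneg_imp_nondecreasing[OF assms(2)])
  fix z assume z: "x \<le> z" "z \<le> y"
  then have z0: "z > 0" "z \<le> 1" using assms by auto
  define g where "g = sin z - z * cos z - z\<^sup>2 * sin z / 3"
  have D: "((\<lambda>x. exp (x ^ 4)) has_real_derivative exp (z ^ 4) * (4 * z ^ 3)) (at z)"
    by (auto intro!: derivative_eq_intros)
  have "z / 2 \<le> 2 / pi * z" using z0 pi_less_4 by (simp add: field_simps)
  also have "\<dots> \<le> sin z" using z0 pi_ge_two by (intro sin_ge_jordan) auto
  finally have "4 * z ^ 4 * (z / 2) \<le> 4 * z ^ 4 * sin z" using z0 by (intro mult_left_mono) auto
  moreover have "g \<le> z ^ 5 / 45" using sin_taylor_gap_le[of z] z0 by (simp add: g_def)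
  moreover have "4 * z ^ 4 * (z / 2) = 2 * z ^ 5" by (simp add: eval_nat_numeral)
  moreover have "0 \<le> z ^ 5" using z0 by simp
  ultimately have g: "g \<le> 4 * z ^ 4 * sin z" by linarith
  have "- (g / z\<^sup>2) * exp (z\<^sup>2 / 6) * exp (z ^ 4)
     + exp (z ^ 4) * (4 * z ^ 3) * (sin z / z * exp (z\<^sup>2 / 6))
     = (4 * z ^ 4 * sin z - g) / z\<^sup>2 * exp (z\<^sup>2 / 6) * exp (z ^ 4)"
    using z0 by (simp add: field_simps eval_nat_numeral)
  also have "\<dots> \<ge> 0" using g by simp
  finally show "\<exists>d. ((\<lambda>x. sin x / x * exp (x\<^sup>2 / 6) * exp (x ^ 4)) has_real_derivative d) (at z) \<and> 0 \<le> d"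
    using DERIV_mult[OF sin_ratio_deriv[OF z0(1)] D] unfolding g_def by blast
qed

text \<open>\<open>R\<close> is the quotient of the values of
  \<open>sin x / x * exp (x\<^sup>2 / 6)\<close> at \<open>y\<close> and at \<open>x\<close>.
  Monotonicity gives \<open>R \<le> 1\<close>; in the lower bound a factor
  \<open>exp (x ^ 4) \<ge> 1\<close> is dropped so that only \<open>y\<close> remains.\<close>

lemma sin_quotient_bounds:
  fixes x y :: real
  assumes "0 < x" "x \<le> y" "y < pi"
  obtains R where "sin y / sin x = y / x * exp (- (y\<^sup>2 - x\<^sup>2) / 6) * R" "0 < R" "R \<le> 1"
    "y \<le> 1 \<Longrightarrow> exp (- (y ^ 4)) \<le> R"
proof
  define h :: "real \<Rightarrow> real" where "h = (\<lambda>x. sin x / x * exp (x\<^sup>2 / 6))"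
  have pos: "sin x > 0" "sin y > 0" "y > 0" using assms by (auto intro!: sin_gt_zero)
  then have h: "h x > 0" "h y > 0" using assms by (auto simp: h_def)
  show "sin y / sin x = y / x * exp (- (y\<^sup>2 - x\<^sup>2) / 6) * (h y / h x)"
  proof -
    have "exp (- (y\<^sup>2 - x\<^sup>2) / 6) * exp (y\<^sup>2 / 6) = exp (x\<^sup>2 / 6)"
      by (simp add: exp_add[symmetric]) (simp add: field_simps)
    then show ?thesis using pos assms(1) by (simp add: h_def field_simps)
  qed
  show "0 < h y / h x" using h by simp
  have "h y \<le> h x" using sin_ratio_antimono[OF assms] by (simp add: h_def)
  then show "h y / h x \<le> 1" using h by simp
  show "exp (- (y ^ 4)) \<le> h y / h x" if "y \<le> 1"
  proof -
    have "h x * 1 \<le> h x * exp (x ^ 4)" using h assms by (intro mult_left_mono) auto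
    also have "\<dots> \<le> h y * exp (y ^ 4)" using sin_ratio_mono[OF assms(1,2) that] by (simp add: h_def)
    finally show ?thesis using h by (simp add: exp_minus field_simps)
  qed
qed

section \<open>Gaussian binomials at frequencies below 2 * pi / n\<close>

lemma qbinom_cnj: "qbinom (cnj q) n k = cnj (qbinom q n k)"
  by (induction q n k rule: qbinom.induct) auto

lemma prod_shifted_quotient: "(\<Prod>j<b. real (a + Suc j) / real (Suc j)) = real (a + b choose b)"
proof (induction b)
  case (Suc b)
  have "real (Suc b) * real (a + Suc b choose Suc b) = real (a + Suc b) * real (a + b choose b)"
    using Suc_times_binomial[of b "a + b"] by (simp only: add_Suc_right of_nat_mult[symmetric])
  with Suc show ?case by (simp del: binomial_Suc_Suc add: field_simps)
qed simp

lemma sum_square_gap: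
  "(\<Sum>j<b. (real (a + Suc j))\<^sup>2 - (real (Suc j))\<^sup>2) = real a * real b * (real a + real b + 1)"
  by (induction b) (auto simp: power2_eq_square algebra_simps)

text \<open>Each factor is \<open>1 - cis (k * x) = - 2 * \<i> * sin (k * x / 2) * cis (k * x /
  2)\<close>. In the quotient the phases add up to \<open>a * b * x / 2\<close>, the ratios of
  half-angles multiply to the binomial coefficient, and the quadratic exponents sum to the variance
  \<open>a * b * (a + b + 1) / 12\<close>. The bound \<open>2 * pi\<close> keeps every half-angle
  below \<open>pi\<close>, where no sine vanishes.\<close>

lemma qbinom_cis_pos:
  assumes x: "0 < x" "real (a + b) * x < 2 * pi"
  shows "\<exists>B. qbinom (cis x) (a + b) b = of_real (real (a + b choose b) * B) * cis (real a * real b * x / 2)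
     \<and> 0 < B \<and> B \<le> exp (- (real a * real b * (real a + real b + 1) / 12) * x\<^sup>2 / 2)
     \<and> (real (a + b) * x \<le> 2 \<longrightarrow>
         exp (- (real a * real b * (real a + real b + 1) / 12) * x\<^sup>2 / 2 - real b * (real (a + b) * x) ^ 4) \<le> B)"
proof -
  define u v where "u = (\<lambda>j. real (Suc j) * x / 2)" and "v = (\<lambda>j. real (a + Suc j) * x / 2)"
  have uv: "0 < u j" "u j \<le> v j" "v j < pi" "v j \<le> real (a + b) * x / 2" if "j < b" for j
  proof -
    show "0 < u j" "u j \<le> v j" using x by (auto simp: u_def v_def)
    show 1: "v j \<le> real (a + b) * x / 2" using x that by (auto simp: v_def)
    show "v j < pi" using 1 x by linarith
  qed
  have "\<exists>R. sin (v j) / sin (u j) = v j / u j * exp (- ((v j)\<^sup>2 - (u j)\<^sup>2) / 6) * R \<and> 0 < R \<and> R \<le> 1 \<and>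
     (v j \<le> 1 \<longrightarrow> exp (- (v j ^ 4)) \<le> R)" if "j < b" for j
    using sin_quotient_bounds[OF uv(1-3)[OF that]] by metis
  then obtain R where R: "\<And>j. j < b \<Longrightarrow> sin (v j) / sin (u j) = v j / u j * exp (- ((v j)\<^sup>2 - (u j)\<^sup>2) / 6) * R j"
     "\<And>j. j < b \<Longrightarrow> 0 < R j" "\<And>j. j < b \<Longrightarrow> R j \<le> 1" "\<And>j. j < b \<Longrightarrow> v j \<le> 1 \<Longrightarrow> exp (- (v j ^ 4)) \<le> R j"
    by metis
  define E where "E = exp (- (real a * real b * (real a + real b + 1) / 12) * x\<^sup>2 / 2)"
  define B where "B = E * (\<Prod>j<b. R j)"
  have fac: "1 - cis x ^ k = (- 2 * \<i>) * (of_real (sin (real k * x / 2)) * cis (real k * x / 2))" for k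
  proof -
    have "1 - cis (2 * t) = (- 2 * \<i>) * (of_real (sin t) * cis t)" for t
      by (simp add: complex_eq_iff cos_double_sin sin_double power2_eq_square)
    from this[of "real k * x / 2"] show ?thesis by (simp add: Complex.DeMoivre)
  qed
  have su: "sin (u j) \<noteq> 0" if "j < b" for j
    using sin_gt_zero[of "u j"] uv[OF that] by fastforce
  have "qbinom (cis x) (a + b) b * (\<Prod>j<b. 1 - cis x ^ Suc j) = (\<Prod>j<b. 1 - cis x ^ (a + Suc j))"
    by (rule qbinom_prod)
  also have "(\<Prod>j<b. 1 - cis x ^ Suc j) = (- 2 * \<i>) ^ b * (\<Prod>j<b. of_real (sin (u j)) * cis (u j))"
    unfolding fac u_def by (subst prod.distrib) (simp only: prod_constant card_lessThan)
  also have "(\<Prod>j<b. 1 - cis x ^ (a + Suc j)) = (- 2 * \<i>) ^ b * (\<Prod>j<b. of_real (sin (v j)) * cis (v j))"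
    unfolding fac v_def by (subst prod.distrib) (simp only: prod_constant card_lessThan)
  also have "(\<Prod>j<b. of_real (sin (v j)) * cis (v j)) =
     (\<Prod>j<b. (of_real (sin (v j) / sin (u j)) * cis (real a * x / 2)) * (of_real (sin (u j)) * cis (u j)))"
  proof (intro prod.cong refl)
    fix j assume "j \<in> {..<b}"
    moreover have "cis (real a * x / 2) * cis (u j) = cis (v j)"
      unfolding cis_mult by (rule arg_cong[of _ _ cis]) (simp add: u_def v_def field_simps)
    ultimately show "of_real (sin (v j)) * cis (v j) =
        (of_real (sin (v j) / sin (u j)) * cis (real a * x / 2)) * (of_real (sin (u j)) * cis (u j))"
      using su[of j] by simp
  qed
  also have "\<dots> = (\<Prod>j<b. of_real (sin (v j) / sin (u j)) * cis (real a * x / 2)) * (\<Prod>j<b. of_real (sin (u j)) * cis (u j))"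
    by (rule prod.distrib)
  finally have eq: "qbinom (cis x) (a + b) b = (\<Prod>j<b. of_real (sin (v j) / sin (u j)) * cis (real a * x / 2))"
    using su by (simp add: mult_ac)
  also have "\<dots> = of_real (\<Prod>j<b. sin (v j) / sin (u j)) * cis (real a * real b * x / 2)"
    by (subst prod.distrib) (simp add: Complex.DeMoivre mult_ac)
  also have "(\<Prod>j<b. sin (v j) / sin (u j)) = (\<Prod>j<b. v j / u j * exp (- ((v j)\<^sup>2 - (u j)\<^sup>2) / 6) * R j)"
    using R(1) by (intro prod.cong) auto
  also have "\<dots> = (\<Prod>j<b. v j / u j) * exp (\<Sum>j<b. - ((v j)\<^sup>2 - (u j)\<^sup>2) / 6) * (\<Prod>j<b. R j)"
    by (simp only: prod.distrib exp_sum[OF finite_lessThan])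
  also have "(\<Prod>j<b. v j / u j) = real (a + b choose b)"
    using x by (simp add: u_def v_def prod_shifted_quotient[symmetric] del: of_nat_Suc)
  also have "exp (\<Sum>j<b. - ((v j)\<^sup>2 - (u j)\<^sup>2) / 6) = E"
  proof -
    have "- ((v j)\<^sup>2 - (u j)\<^sup>2) / 6 = - (x\<^sup>2 / 24) * ((real (a + Suc j))\<^sup>2 - (real (Suc j))\<^sup>2)" for j
      by (simp add: u_def v_def power_mult_distrib power_divide field_simps del: of_nat_Suc of_nat_add)
    then have "(\<Sum>j<b. - ((v j)\<^sup>2 - (u j)\<^sup>2) / 6) = - (x\<^sup>2 / 24) * (real a * real b * (real a + real b + 1))"
      by (simp only: sum_distrib_left[symmetric] sum_square_gap)
    then show ?thesis by (simp add: E_def)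
  qed
  finally have "qbinom (cis x) (a + b) b = of_real (real (a + b choose b) * B) * cis (real a * real b * x / 2)"
    by (simp add: B_def mult.assoc)
  moreover have "0 < B" unfolding B_def E_def using R(2) by (auto intro!: mult_pos_pos prod_pos)
  moreover have "B \<le> E"
  proof -
    have "(\<Prod>j<b. R j) \<le> (\<Prod>j<b. 1)" using R(2,3) by (intro prod_mono) (auto intro: less_imp_le)
    then show ?thesis unfolding B_def by (simp add: E_def)
  qed
  moreover have "E * exp (- real b * (real (a + b) * x) ^ 4) \<le> B" if le: "real (a + b) * x \<le> 2"
  proof -
    have "exp (- real b * (real (a + b) * x) ^ 4) = (\<Prod>j<b. exp (- ((real (a + b) * x) ^ 4)))"
      by (simp add: exp_of_nat_mult[symmetric])
    also have "\<dots> \<le> (\<Prod>j<b. R j)"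
    proof (intro prod_mono conjI)
      fix j assume "j \<in> {..<b}"
      then have j: "j < b" by simp
      have "v j \<le> real (a + b) * x" using uv(4)[OF j] x by (smt (verit) mult_nonneg_nonneg of_nat_0_le_iff field_sum_of_halves)
      then have "v j ^ 4 \<le> (real (a + b) * x) ^ 4"
        using uv[OF j] by (intro power_mono) auto
      then have "exp (- ((real (a + b) * x) ^ 4)) \<le> exp (- (v j ^ 4))" by simp
      \<comment> \<open>The assumption on \<open>x\<close> means \<open>v j \<le> 1\<close>, the
        range in which \<open>R j\<close> is bounded below.\<close>
      also have "\<dots> \<le> R j" using le uv(4)[OF j] by (intro R(4)[OF j]) auto
      finally show "exp (- ((real (a + b) * x) ^ 4)) \<le> R j" .
    qed auto
    finally show ?thesis unfolding B_def by (intro mult_left_mono) (auto simp: E_def)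
  qed
  ultimately show ?thesis
    unfolding E_def by (auto simp: exp_add[symmetric] intro!: exI[of _ B])
qed

lemma qbinom_cis:
  assumes "real (a + b) * \<bar>x\<bar> < 2 * pi"
  shows "\<exists>B. qbinom (cis x) (a + b) b = of_real (real (a + b choose b) * B) * cis (real a * real b * x / 2)
     \<and> 0 < B \<and> B \<le> exp (- (real a * real b * (real a + real b + 1) / 12) * x\<^sup>2 / 2)
     \<and> (real (a + b) * \<bar>x\<bar> \<le> 2 \<longrightarrow>
         exp (- (real a * real b * (real a + real b + 1) / 12) * x\<^sup>2 / 2 - real b * (real (a + b) * x) ^ 4) \<le> B)"
proof (cases x "0 :: real" rule: linorder_cases)
  case equal
  then show ?thesis by (intro exI[of _ 1]) (auto simp: qbinom_1)
next
  case greater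
  then show ?thesis using qbinom_cis_pos[of x a b] assms by simp
next
  case less
  then obtain B where B: "qbinom (cis (- x)) (a + b) b = of_real (real (a + b choose b) * B) * cis (real a * real b * (- x) / 2)"
     "0 < B" "B \<le> exp (- (real a * real b * (real a + real b + 1) / 12) * (- x)\<^sup>2 / 2)"
     "real (a + b) * (- x) \<le> 2 \<Longrightarrow>
         exp (- (real a * real b * (real a + real b + 1) / 12) * (- x)\<^sup>2 / 2 - real b * (real (a + b) * (- x)) ^ 4) \<le> B"
    using qbinom_cis_pos[of "- x" a b] assms by auto
  have "qbinom (cis x) (a + b) b = cnj (qbinom (cis (- x)) (a + b) b)"
    by (simp add: qbinom_cnj[symmetric] cis_cnj)
  also have "\<dots> = of_real (real (a + b choose b) * B) * cis (real a * real b * x / 2)"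
    unfolding B(1) by (simp add: cis_cnj)
  finally show ?thesis using B(2-4) less by (intro exI[of _ B]) (simp add: power_mult_distrib)
qed

section \<open>The characteristic function of the multinomial coefficients\<close>

definition msize :: "nat \<Rightarrow> (nat \<Rightarrow> nat) \<Rightarrow> nat" where
  "msize r ns = (\<Sum>i=1..r. ns i)"

lemma msize_0 [simp]: "msize 0 ns = 0" and msize_Suc: "msize (Suc r) ns = msize r ns + ns (Suc r)"
  by (simp_all add: msize_def)

text \<open>The value at \<open>q = 1\<close>, that is the ordinary multinomial coefficient;
  dividing by it gives the coefficients total mass 1.\<close>

definition mcount :: "nat \<Rightarrow> (nat \<Rightarrow> nat) \<Rightarrow> real" where
  "mcount r ns = poly (qmultinomial r ns) 1"

lemma mcount_0 [simp]: "mcount 0 ns = 1"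
  and mcount_Suc: "mcount (Suc r) ns = mcount r ns * real (msize r ns + ns (Suc r) choose ns (Suc r))"
  by (simp_all add: mcount_def qmultinomial_0 qmultinomial_Suc poly_qbinom qbinom_1 msize_def)

lemma mcount_pos: "mcount r ns > 0"
  by (induction r) (auto simp: mcount_Suc)

text \<open>This is the variance of the coefficient distribution. For \<open>r \<ge> 3\<close> it exceeds \<open>qmult_var\<close>, by one sixth of the
  third elementary symmetric function of the parts. The discrepancy is harmless: it only shrinks the
  window, and real-rootedness does not depend on the scaling.\<close>

primrec inv_var :: "nat \<Rightarrow> (nat \<Rightarrow> nat) \<Rightarrow> real" where
  "inv_var 0 ns = 0"
| "inv_var (Suc r) ns = inv_var r ns + real (msize r ns) * real (ns (Suc r)) * (real (msize r ns) + real (ns (Suc r)) + 1) / 12"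

lemma sum_pairs_Suc:
  fixes f :: "nat \<Rightarrow> nat \<Rightarrow> 'a::comm_monoid_add"
  shows "(\<Sum>i=1..Suc r. \<Sum>j\<in>{i<..Suc r}. f i j) = (\<Sum>i=1..r. \<Sum>j\<in>{i<..r}. f i j) + (\<Sum>i=1..r. f i (Suc r))"
proof -
  have "(\<Sum>j\<in>{i<..Suc r}. f i j) = (\<Sum>j\<in>{i<..r}. f i j) + f i (Suc r)" if "i \<in> {1..r}" for i
  proof -
    have "{i<..Suc r} = insert (Suc r) {i<..r}" using that by auto
    then show ?thesis by (simp add: add.commute)
  qed
  then have "(\<Sum>i=1..r. \<Sum>j\<in>{i<..Suc r}. f i j) = (\<Sum>i=1..r. (\<Sum>j\<in>{i<..r}. f i j) + f i (Suc r))"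
    by (rule sum.cong[OF refl])
  then show ?thesis by (simp add: sum.distrib)
qed

lemma qmult_deg_Suc: "qmult_deg (Suc r) ns = qmult_deg r ns + msize r ns * ns (Suc r)"
  unfolding qmult_deg_def sum_pairs_Suc msize_def by (simp add: sum_distrib_right)

lemma qmult_mean_Suc: "qmult_mean (Suc r) ns = qmult_mean r ns + real (msize r ns) * real (ns (Suc r)) / 2"
proof -
  have "(\<Sum>i=1..r. real (ns i) * real (ns (Suc r))) = real (msize r ns) * real (ns (Suc r))"
    by (simp add: msize_def sum_distrib_right)
  then show ?thesis unfolding qmult_mean_def sum_pairs_Suc by (simp only:) (simp add: algebra_simps)
qed

lemma qmult_var_le: "qmult_var r ns \<le> inv_var r ns"
proof (induction r)
  case (Suc r)
  have "(\<Sum>i=1..r. real (ns i) * real (ns (Suc r)) * (real (ns i) + real (ns (Suc r)) + 1)) \<le>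
     (\<Sum>i=1..r. real (ns i) * real (ns (Suc r)) * (real (msize r ns) + real (ns (Suc r)) + 1))"
  proof (intro sum_mono mult_left_mono)
    fix i assume "i \<in> {1..r}"
    then have "ns i \<le> msize r ns" unfolding msize_def by (intro member_le_sum) auto
    then show "real (ns i) + real (ns (Suc r)) + 1 \<le> real (msize r ns) + real (ns (Suc r)) + 1" by simp
  qed auto
  also have "\<dots> = real (msize r ns) * real (ns (Suc r)) * (real (msize r ns) + real (ns (Suc r)) + 1)"
    by (simp add: msize_def sum_distrib_right)
  finally have le: "(\<Sum>i=1..r. real (ns i) * real (ns (Suc r)) * (real (ns i) + real (ns (Suc r)) + 1)) \<le> \<dots>" .
  have "1 / 12 * (X + Y) \<le> v + Z / 12" if "1 / 12 * X \<le> v" "Y \<le> Z" for X Y Z v :: real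
    using that by (simp add: field_simps)
  from this[OF Suc[unfolded qmult_var_def] le] show ?case
    unfolding qmult_var_def sum_pairs_Suc inv_var.simps .
qed (simp add: qmult_var_def)

lemma inv_var_le: "inv_var r ns \<le> real (msize r ns) ^ 3"
proof (induction r)
  case (Suc r)
  define a b where "a = real (msize r ns)" and "b = real (ns (Suc r))"
  \<comment> \<open>The factor 3 lets the induction close through
    \<open>(a + b) ^ 3 = a ^ 3 + 3 * a * b * (a + b) + b ^ 3\<close>.\<close>
  have "a * b * (a + b + 1) / 12 \<le> 3 * a * b * (a + b)"
  proof (cases "a = 0 \<or> b = 0")
    case False
    then have "a \<ge> 1" "b \<ge> 1" by (auto simp: a_def b_def)
    then have "(a * b) * (a + b + 1) \<le> (a * b) * (36 * (a + b))" by (intro mult_left_mono) auto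
    then show ?thesis by (simp add: algebra_simps)
  qed auto
  with Suc have "inv_var (Suc r) ns \<le> a ^ 3 + 3 * a * b * (a + b)" by (simp add: a_def b_def)
  also have "\<dots> \<le> (a + b) ^ 3" by (simp add: power3_eq_cube algebra_simps b_def)
  finally show ?case by (simp add: a_def b_def msize_Suc)
qed simp

lemma inv_var_nonneg: "inv_var r ns \<ge> 0"
  by (induction r) auto

lemma degree_qbinom_le: "degree (qbinom ([:0, 1:] :: 'a::idom poly) n k) \<le> k * (n - k)"
proof (induction "[:0, 1:] :: 'a poly" n k rule: qbinom.induct)
  case (3 n k)
  show ?case
  proof (cases "k < n")
    case True
    have "degree (([:0, 1:] :: 'a poly) ^ Suc k * qbinom [:0, 1:] n (Suc k)) \<le> Suc k + Suc k * (n - Suc k)"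
      using 3 by (intro order_trans[OF degree_mult_le] add_mono order_trans[OF degree_power_le]) auto
    also have "\<dots> = Suc k * (Suc n - Suc k)" using True by (simp add: Suc_diff_Suc[symmetric] algebra_simps)
    finally show ?thesis
      using 3(1) by (auto simp del: power_Suc intro!: degree_add_le elim!: order_trans)
  qed (use 3 in \<open>auto simp: qbinom_eq_0\<close>)
qed auto

lemma degree_qmultinomial_le: "degree (qmultinomial r ns) \<le> qmult_deg r ns"
proof (induction r)
  case (Suc r)
  have "degree (qbinom ([:0, 1:] :: real poly) (msize r ns + ns (Suc r)) (ns (Suc r))) \<le> msize r ns * ns (Suc r)"
    using degree_qbinom_le[of "msize r ns + ns (Suc r)" "ns (Suc r)"] by (simp add: mult.commute)
  with Suc show ?case unfolding qmultinomial_Suc qmult_deg_Suc msize_def[symmetric]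
    by (intro order_trans[OF degree_mult_le] add_mono)
qed (simp add: qmultinomial_0)

abbreviation qmult_char :: "nat \<Rightarrow> (nat \<Rightarrow> nat) \<Rightarrow> real \<Rightarrow> complex" where
  "qmult_char r ns x \<equiv> cpoly (qmultinomial r ns) (cis x)"

lemma qmult_char_Suc:
  "qmult_char (Suc r) ns x = qmult_char r ns x * qbinom (cis x) (msize r ns + ns (Suc r)) (ns (Suc r))"
  by (simp add: qmultinomial_Suc cpoly_mult cpoly_qbinom cpoly_pCons msize_def)

lemma norm_qmult_char_le: "norm (qmult_char r ns x) \<le> mcount r ns"
proof (induction r)
  case (Suc r)
  then show ?case unfolding qmult_char_Suc mcount_Suc norm_mult
    using mcount_pos[of r ns] by (intro mult_mono norm_qbinom_le) auto
qed (simp add: qmultinomial_0)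

text \<open>Only the last Gaussian factor supplies decay, and its parts sum to the full size, which
  fixes the threshold. The other factors are bounded by their values at
  \<open>q = 1\<close>.\<close>

lemma norm_qmult_char_outer:
  assumes "2 * pi / real (msize (Suc r) ns) \<le> \<bar>x\<bar>" "\<bar>x\<bar> \<le> pi" "msize (Suc r) ns > 0"
  shows "norm (qmult_char (Suc r) ns x) \<le> mcount (Suc r) ns * ((real (msize (Suc r) ns) + 1)
    * exp (- (real (msize r ns) * real (ns (Suc r)) / (2 * real (msize (Suc r) ns)))))"
proof -
  have "norm (qmult_char (Suc r) ns x) \<le> mcount r ns *
      (real (msize r ns + ns (Suc r) + 1) * real (msize r ns + ns (Suc r) choose ns (Suc r))
        * exp (- (real (msize r ns) * real (ns (Suc r)) / (2 * real (msize r ns + ns (Suc r))))))"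
    unfolding qmult_char_Suc norm_mult
    using assms mcount_pos[of r ns] unfolding msize_Suc
    by (intro mult_mono norm_qmult_char_le norm_qbinom_cis_le) auto
  then show ?thesis by (simp add: mcount_Suc msize_Suc mult_ac add_ac)
qed

text \<open>Over the Gaussian factors the phases add up to the mean and the quadratic exponents to
  \<open>inv_var\<close>. In the quartic error every partial size is enlarged to the full one, and
  the weights \<open>ns i\<close> sum to \<open>msize r ns\<close>.\<close>

lemma qmult_char_inner:
  assumes "real (msize r ns) * \<bar>x\<bar> < 2 * pi"
  shows "\<exists>B. qmult_char r ns x = of_real (mcount r ns * B) * cis (qmult_mean r ns * x)
     \<and> 0 < B \<and> B \<le> exp (- inv_var r ns * x\<^sup>2 / 2)
     \<and> (real (msize r ns) * \<bar>x\<bar> \<le> 2 \<longrightarrow>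
         exp (- inv_var r ns * x\<^sup>2 / 2 - real (msize r ns) * (real (msize r ns) * x) ^ 4) \<le> B)"
  using assms
proof (induction r)
  case 0
  then show ?case by (intro exI[of _ 1]) (simp add: qmultinomial_0 qmult_mean_def)
next
  case (Suc r)
  define a b where "a = msize r ns" and "b = ns (Suc r)"
  have ab: "msize (Suc r) ns = a + b" by (simp add: a_def b_def msize_Suc)
  have le: "real a * \<bar>x\<bar> \<le> real (a + b) * \<bar>x\<bar>" by (intro mult_right_mono) auto
  then have "real a * \<bar>x\<bar> < 2 * pi" using Suc.prems unfolding ab by linarith
  from Suc.IH[folded a_def, OF this] obtain B where
    B: "qmult_char r ns x = of_real (mcount r ns * B) * cis (qmult_mean r ns * x)"
     "0 < B" "B \<le> exp (- inv_var r ns * x\<^sup>2 / 2)"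
     "real a * \<bar>x\<bar> \<le> 2 \<Longrightarrow> exp (- inv_var r ns * x\<^sup>2 / 2 - real a * (real a * x) ^ 4) \<le> B"
    by blast
  define v where "v = real a * real b * (real a + real b + 1) / 12"
  from qbinom_cis[of a b x] Suc.prems obtain B' where
    B': "qbinom (cis x) (a + b) b = of_real (real (a + b choose b) * B') * cis (real a * real b * x / 2)"
     "0 < B'" "B' \<le> exp (- v * x\<^sup>2 / 2)"
     "real (a + b) * \<bar>x\<bar> \<le> 2 \<Longrightarrow> exp (- v * x\<^sup>2 / 2 - real b * (real (a + b) * x) ^ 4) \<le> B'"
    unfolding ab v_def by blast
  have var: "inv_var (Suc r) ns = inv_var r ns + v" by (simp add: a_def b_def v_def)
  show ?case
  proof (intro exI conjI impI)
    have "qmult_char (Suc r) ns x = of_real (mcount (Suc r) ns * (B * B')) *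
        (cis (qmult_mean r ns * x) * cis (real a * real b * x / 2))"
      unfolding qmult_char_Suc a_def[symmetric] b_def[symmetric] B(1) B'(1)
      by (simp add: mcount_Suc a_def b_def mult_ac)
    also have "cis (qmult_mean r ns * x) * cis (real a * real b * x / 2) = cis (qmult_mean (Suc r) ns * x)"
      by (simp add: cis_mult qmult_mean_Suc a_def b_def algebra_simps)
    finally show "qmult_char (Suc r) ns x = of_real (mcount (Suc r) ns * (B * B')) * cis (qmult_mean (Suc r) ns * x)" .
    show "0 < B * B'" using B B' by simp
    have "B * B' \<le> exp (- inv_var r ns * x\<^sup>2 / 2) * exp (- v * x\<^sup>2 / 2)"
      using B B' by (intro mult_mono) auto
    then show "B * B' \<le> exp (- inv_var (Suc r) ns * x\<^sup>2 / 2)"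
      unfolding var by (simp add: exp_add[symmetric] algebra_simps add_divide_distrib diff_divide_distrib)
    assume "real (msize (Suc r) ns) * \<bar>x\<bar> \<le> 2"
    then have le2: "real (a + b) * \<bar>x\<bar> \<le> 2" unfolding ab .
    have "(real a * \<bar>x\<bar>) ^ 4 \<le> (real (a + b) * \<bar>x\<bar>) ^ 4"
      using le by (intro power_mono) auto
    then have "(real a * x) ^ 4 \<le> (real (a + b) * x) ^ 4"
      by (simp add: power_mult_distrib)
    then have "real a * (real a * x) ^ 4 \<le> real a * (real (a + b) * x) ^ 4"
      by (intro mult_left_mono) auto
    moreover have "- inv_var (Suc r) ns * x\<^sup>2 / 2 = - inv_var r ns * x\<^sup>2 / 2 + - v * x\<^sup>2 / 2"
      unfolding var by (simp add: field_simps)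
    moreover have "real (a + b) * Q = real a * Q + real b * Q" for Q by (simp add: algebra_simps)
    ultimately have "- inv_var (Suc r) ns * x\<^sup>2 / 2 - real (a + b) * (real (a + b) * x) ^ 4 \<le>
       (- inv_var r ns * x\<^sup>2 / 2 - real a * (real a * x) ^ 4) + (- v * x\<^sup>2 / 2 - real b * (real (a + b) * x) ^ 4)"
      by (simp only:)
    then have "exp (- inv_var (Suc r) ns * x\<^sup>2 / 2 - real (a + b) * (real (a + b) * x) ^ 4) \<le>
       exp ((- inv_var r ns * x\<^sup>2 / 2 - real a * (real a * x) ^ 4) + (- v * x\<^sup>2 / 2 - real b * (real (a + b) * x) ^ 4))"
      by (simp only: exp_le_cancel_iff)
    also have "\<dots> \<le> B * B'"
      unfolding exp_add using B(4) B'(4) le le2 B(2) by (intro mult_mono) auto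
    finally show "exp (- inv_var (Suc r) ns * x\<^sup>2 / 2 - real (msize (Suc r) ns) * (real (msize (Suc r) ns) * x) ^ 4) \<le> B * B'"
      unfolding ab .
  qed
qed

text \<open>Fourier inversion: raising the index by 1 multiplies the integrand by
  \<open>cis (- x)\<close>, so each difference contributes \<open>cis (- x) - 1\<close>.\<close>

lemma has_bochner_integral_fdiff_qmult_coeff:
  "has_bochner_integral lborel
     (\<lambda>x. indicator {- pi..pi} x *\<^sub>R (qmult_char r ns x * cis (- of_int m * x) * (cis (- x) - 1) ^ i))
     (of_real (2 * pi * (fdiff ^^ i) (qmult_coeff r ns) m))"
proof (induction i arbitrary: m)
  case 0
  have "has_bochner_integral lborel
     (\<lambda>x. indicator {- pi..pi} x *\<^sub>R ((\<Sum>k\<le>qmult_deg r ns. of_real (coeff (qmultinomial r ns) k) * cis x ^ k) * cis (- of_int m * x)))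
     (complex_of_real (2 * pi) * (if 0 \<le> m \<and> m \<le> int (qmult_deg r ns) then of_real (coeff (qmultinomial r ns) (nat m)) else 0))"
    by (rule has_bochner_integral_fourier_coeff)
  also have "complex_of_real (2 * pi) * (if 0 \<le> m \<and> m \<le> int (qmult_deg r ns) then of_real (coeff (qmultinomial r ns) (nat m)) else 0)
     = complex_of_real (2 * pi * (fdiff ^^ 0) (qmult_coeff r ns) m)"
    by (simp add: qmult_coeff_def)
  finally show ?case by (simp add: cpoly_altdef[OF degree_qmultinomial_le])
next
  case (Suc i)
  have "has_bochner_integral lborel
     (\<lambda>x. indicator {- pi..pi} x *\<^sub>R (qmult_char r ns x * cis (- of_int (m + 1) * x) * (cis (- x) - 1) ^ i)
        - indicator {- pi..pi} x *\<^sub>R (qmult_char r ns x * cis (- of_int m * x) * (cis (- x) - 1) ^ i))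
     (of_real (2 * pi * (fdiff ^^ i) (qmult_coeff r ns) (m + 1)) - of_real (2 * pi * (fdiff ^^ i) (qmult_coeff r ns) m))"
    by (intro has_bochner_integral_diff Suc.IH)
  also have "(\<lambda>x. indicator {- pi..pi} x *\<^sub>R (qmult_char r ns x * cis (- of_int (m + 1) * x) * (cis (- x) - 1) ^ i)
        - indicator {- pi..pi} x *\<^sub>R (qmult_char r ns x * cis (- of_int m * x) * (cis (- x) - 1) ^ i))
     = (\<lambda>x. indicator {- pi..pi} x *\<^sub>R (qmult_char r ns x * cis (- of_int m * x) * (cis (- x) - 1) ^ Suc i))"
  proof
    fix x
    have "cis (- of_int (m + 1) * x) = cis (- of_int m * x) * cis (- x)"
      by (simp add: cis_mult algebra_simps)
    then show "indicator {- pi..pi} x *\<^sub>R (qmult_char r ns x * cis (- of_int (m + 1) * x) * (cis (- x) - 1) ^ i)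
        - indicator {- pi..pi} x *\<^sub>R (qmult_char r ns x * cis (- of_int m * x) * (cis (- x) - 1) ^ i)
      = indicator {- pi..pi} x *\<^sub>R (qmult_char r ns x * cis (- of_int m * x) * (cis (- x) - 1) ^ Suc i)"
      by (simp only: scaleR_diff_right[symmetric]) (simp add: algebra_simps)
  qed
  finally show ?case by (simp add: fdiff_def algebra_simps)
qed

section \<open>The local limit theorem\<close>

lemma norm_cis_minus_1_le: "norm (cis x - 1) \<le> \<bar>x\<bar>"
  using abs_sin_x_le_abs_x[of "x / 2"] by (simp add: norm_cis_minus_1)

lemma cis_difference_quotient_tendsto:
  assumes "h \<longlonglongrightarrow> 0" "\<And>k. h k \<noteq> (0::real)"
  shows "(\<lambda>k. (cis (h k * t) - 1) / of_real (h k)) \<longlonglongrightarrow> \<i> * t"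
proof -
  have "((\<lambda>z. exp (\<i> * of_real t * z)) has_field_derivative \<i> * of_real t) (at 0)"
    by (auto intro!: derivative_eq_intros)
  then have "((\<lambda>z. (exp (\<i> * of_real t * (0 + z)) - exp (\<i> * of_real t * 0)) / z) \<longlongrightarrow> \<i> * of_real t) (at 0)"
    by (rule DERIV_D)
  moreover have "filterlim (\<lambda>k. complex_of_real (h k)) (at 0) sequentially"
    using assms tendsto_of_real[OF assms(1), where 'a = complex] by (auto simp: filterlim_at)
  ultimately have "(\<lambda>k. (exp (\<i> * of_real t * (0 + of_real (h k))) - exp (\<i> * of_real t * 0)) / of_real (h k)) \<longlonglongrightarrow> \<i> * of_real t"
    by (rule filterlim_compose)
  then show ?thesis by (simp add: cis_conv_exp mult_ac)
qed

text \<open>The \<open>i\<close>-th derivative in \<open>x\<close> of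
  \<open>exp (- t\<^sup>2 / 2) * cis (- x * t)\<close>; it is the pointwise limit of the rescaled
  inversion integrand.\<close>

definition gauss_moment :: "nat \<Rightarrow> real \<Rightarrow> real \<Rightarrow> complex" where
  "gauss_moment i x t = of_real (exp (- t\<^sup>2 / 2)) * cis (- x * t) * (- \<i> * of_real t) ^ i"

lemma norm_gauss_moment: "norm (gauss_moment i x t) = \<bar>t\<bar> ^ i * exp (- t\<^sup>2 / 2)"
  by (simp add: gauss_moment_def norm_mult norm_power)

lemma integrable_gauss_abs_moment: "integrable lborel (\<lambda>t::real. \<bar>t\<bar> ^ i * exp (- t\<^sup>2 / 2))"
proof -
  have "integrable lborel (\<lambda>t. sqrt (2 * pi) * (std_normal_density t * \<bar>t\<bar> ^ i))"
    by (intro integrable_mult_right integrable_std_normal_moment_abs)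
  also have "(\<lambda>t. sqrt (2 * pi) * (std_normal_density t * \<bar>t\<bar> ^ i)) = (\<lambda>t::real. \<bar>t\<bar> ^ i * exp (- t\<^sup>2 / 2))"
    by (auto simp: fun_eq_iff std_normal_density_def)
  finally show ?thesis .
qed

lemma gauss_moment_measurable [measurable]: "gauss_moment i x \<in> borel_measurable lborel"
proof -
  have "continuous_on UNIV (gauss_moment i x)"
    unfolding gauss_moment_def[abs_def] by (intro continuous_intros) auto
  then show ?thesis by (simp add: borel_measurable_continuous_onI)
qed

lemma integrable_gauss_moment: "integrable lborel (gauss_moment i x)"
  by (rule Bochner_Integration.integrable_bound[OF integrable_gauss_abs_moment[of i]])
     (auto simp: norm_gauss_moment)

lemma integral_gauss_moment_0:
  "integral\<^sup>L lborel (gauss_moment 0 x) = of_real (2 * pi * std_normal_density x)"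
proof -
  have "char std_normal_distribution (- x) = (\<integral>t. std_normal_density t *\<^sub>R iexp (- x * t) \<partial>lborel)"
    unfolding char_def by (subst integral_density) (auto intro!: normal_density_nonneg)
  also have "\<dots> = (\<integral>t. of_real (1 / sqrt (2 * pi)) * gauss_moment 0 x t \<partial>lborel)"
    by (intro Bochner_Integration.integral_cong)
       (auto simp: gauss_moment_def std_normal_density_def cis_conv_exp scaleR_conv_of_real mult_ac)
  also have "\<dots> = of_real (1 / sqrt (2 * pi)) * integral\<^sup>L lborel (gauss_moment 0 x)"
    by (simp only: integral_mult_right_zero)
  finally have "of_real (1 / sqrt (2 * pi)) * integral\<^sup>L lborel (gauss_moment 0 x) = complex_of_real (exp (- x\<^sup>2 / 2))"
    by (simp add: char_std_normal_distribution)
  then have "integral\<^sup>L lborel (gauss_moment 0 x) = of_real (sqrt (2 * pi)) * complex_of_real (exp (- x\<^sup>2 / 2))"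
    by (simp add: field_simps)
  also have "sqrt (2 * pi) = 2 * pi * (1 / sqrt (2 * pi))"
    by (simp add: real_div_sqrt)
  finally show ?thesis by (simp add: std_normal_density_def)
qed

definition hermite_density :: "nat \<Rightarrow> real \<Rightarrow> real" where
  "hermite_density i x = (- 1) ^ i * poly (hermite i) x * std_normal_density x"

lemma hermite_density_has_deriv:
  "(hermite_density i has_real_derivative hermite_density (Suc i) x) (at x)"
  unfolding hermite_density_def[abs_def]
  using DERIV_cmult[OF hermite_density_deriv[of i 0 x], of "(- 1) ^ i"] by (simp add: mult.assoc)

text \<open>Differentiation under the integral sign, by dominated convergence of difference
  quotients: \<open>norm (cis x - 1) \<le> \<bar>x\<bar>\<close> yields a majorant with one more
  power of \<open>\<bar>t\<bar>\<close>.\<close>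

lemma integral_gauss_moment:
  "integral\<^sup>L lborel (gauss_moment i x) = of_real (2 * pi * hermite_density i x)"
proof (induction i arbitrary: x)
  case 0
  show ?case by (simp add: integral_gauss_moment_0 hermite_density_def)
next
  case (Suc i)
  define h :: "nat \<Rightarrow> real" where "h = (\<lambda>k. 1 / real (Suc k))"
  have h: "h \<longlonglongrightarrow> 0" "\<And>k. h k \<noteq> 0"
    unfolding h_def using LIMSEQ_inverse_real_of_nat by (auto simp: inverse_eq_divide)
  define D where "D = (\<lambda>k t. (gauss_moment i (x + h k) t - gauss_moment i x t) / of_real (h k))"
  have D_eq: "D k t = gauss_moment i x t * ((cis (h k * (- t)) - 1) / of_real (h k))" for k t
  proof -
    have "cis (- (x + h k) * t) = cis (- x * t) * cis (h k * (- t))"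
      by (simp add: cis_mult algebra_simps)
    then show ?thesis by (simp add: D_def gauss_moment_def algebra_simps diff_divide_distrib)
  qed
  have "(\<lambda>k. integral\<^sup>L lborel (D k)) \<longlonglongrightarrow> integral\<^sup>L lborel (gauss_moment (Suc i) x)"
  proof (rule integral_dominated_convergence)
    show "integrable lborel (\<lambda>t::real. \<bar>t\<bar> ^ Suc i * exp (- t\<^sup>2 / 2))"
      by (rule integrable_gauss_abs_moment)
    show "D k \<in> borel_measurable lborel" for k unfolding D_def by measurable
    have "(\<lambda>k. D k t) \<longlonglongrightarrow> gauss_moment (Suc i) x t" for t
    proof -
      have "(\<lambda>k. D k t) \<longlonglongrightarrow> gauss_moment i x t * (\<i> * of_real (- t))"
        unfolding D_eq by (intro tendsto_mult tendsto_const cis_difference_quotient_tendsto h)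
      then show ?thesis by (simp add: gauss_moment_def mult_ac)
    qed
    then show "AE t in lborel. (\<lambda>k. D k t) \<longlonglongrightarrow> gauss_moment (Suc i) x t" by simp
    have "norm (D k t) \<le> \<bar>t\<bar> ^ Suc i * exp (- t\<^sup>2 / 2)" for k t
    proof -
      have "norm (cis (h k * (- t)) - 1) / \<bar>h k\<bar> \<le> \<bar>h k * (- t)\<bar> / \<bar>h k\<bar>"
        by (intro divide_right_mono norm_cis_minus_1_le) auto
      also have "\<dots> = \<bar>t\<bar>" using h(2)[of k] by (simp add: abs_mult)
      finally have "norm (D k t) \<le> \<bar>t\<bar> ^ i * exp (- t\<^sup>2 / 2) * \<bar>t\<bar>"
        unfolding D_eq norm_mult norm_divide norm_gauss_moment
        by (intro mult_left_mono) auto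
      then show ?thesis by (simp add: mult_ac)
    qed
    then show "AE t in lborel. norm (D k t) \<le> \<bar>t\<bar> ^ Suc i * exp (- t\<^sup>2 / 2)" for k by simp
  qed auto
  moreover have "integral\<^sup>L lborel (D k) = of_real (2 * pi * ((hermite_density i (x + h k) - hermite_density i x) / h k))" for k
    unfolding D_def
    by (simp add: Suc.IH Bochner_Integration.integral_diff integrable_gauss_moment algebra_simps diff_divide_distrib)
  moreover have "(\<lambda>k. complex_of_real (2 * pi * ((hermite_density i (x + h k) - hermite_density i x) / h k)))
      \<longlonglongrightarrow> of_real (2 * pi * hermite_density (Suc i) x)"
  proof (intro tendsto_of_real tendsto_mult tendsto_const)
    have "filterlim h (at 0) sequentially" using h by (auto simp: filterlim_at)
    from filterlim_compose[OF DERIV_D[OF hermite_density_has_deriv] this]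
    show "(\<lambda>k. (hermite_density i (x + h k) - hermite_density i x) / h k) \<longlonglongrightarrow> hermite_density (Suc i) x" .
  qed
  ultimately show ?case using LIMSEQ_unique by simp
qed

text \<open>In the outer range the rescaled frequency satisfies
  \<open>\<bar>t\<bar> \<le> pi * n\<^sup>2\<close>, so this bounds
  \<open>\<bar>t\<bar> ^ i * (1 + t\<^sup>2)\<close> times the decay and makes
  \<open>K / (1 + t\<^sup>2)\<close> an integrable majorant.\<close>

lemma exp_decay_bound:
  assumes "c > 0"
  shows "\<exists>K. \<forall>n::nat. (pi * real n ^ 2) ^ i * (1 + (pi * real n ^ 2)\<^sup>2) * ((real n + 1) * exp (- c * real n)) \<le> K"
proof -
  have "(\<lambda>n::nat. (pi * real n ^ 2) ^ i * (1 + (pi * real n ^ 2)\<^sup>2) * ((real n + 1) * exp (- c * real n))) \<longlonglongrightarrow> 0"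
    using assms by real_asymp
  then have "Bseq (\<lambda>n::nat. (pi * real n ^ 2) ^ i * (1 + (pi * real n ^ 2)\<^sup>2) * ((real n + 1) * exp (- c * real n)))"
    by (intro convergent_imp_Bseq) (auto simp: convergent_def)
  then obtain K where "\<And>n. norm ((pi * real n ^ 2) ^ i * (1 + (pi * real n ^ 2)\<^sup>2) * ((real n + 1) * exp (- c * real n))) \<le> K"
    by (auto simp: Bseq_def)
  then show ?thesis by (intro exI[of _ K]) (metis norm_ge_zero real_norm_def abs_le_D1)
qed

lemma integrable_inverse_1_plus_square_real: "integrable lborel (\<lambda>t::real. 1 / (1 + t\<^sup>2))"
  using integrable_inverse_1_plus_square by (simp add: set_integrable_def einterval_def inverse_eq_divide)

text \<open>The setting for a sequence extracted by compactness: size and proportion bounds hold at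
  every index, not merely eventually.\<close>

locale qmult_sequence =
  fixes r :: nat and eps :: real and ns :: "nat \<Rightarrow> nat \<Rightarrow> nat"
  assumes r_ge_2: "r \<ge> 2" and eps_pos: "eps > 0"
    and msize_at_top: "filterlim (\<lambda>j. msize r (ns j)) at_top sequentially"
    and msize_pos: "\<And>j. msize r (ns j) > 0"
    and proportion_ge: "\<And>i j. i \<in> {1..r} \<Longrightarrow> eps * real (msize r (ns j)) \<le> real (ns j i)"
begin

abbreviation "\<mu> j \<equiv> qmult_mean r (ns j)"
abbreviation "N j \<equiv> real (msize r (ns j))"
abbreviation "T j \<equiv> mcount r (ns j)"
definition "\<sigma> j = sqrt (inv_var r (ns j))"

text \<open>Once the last part is split off, both pieces are linear in the size, as the front piece
  contains \<open>ns j 1\<close>. The cubic lower bound for the variance and the exponential decay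
  both rest on this.\<close>

lemma last_split:
  obtains r' where "r = Suc r'" "eps * N j \<le> real (msize r' (ns j))" "eps * N j \<le> real (ns j (Suc r'))"
proof
  show r: "r = Suc (r - 1)" using r_ge_2 by simp
  have "eps * N j \<le> real (ns j 1)" using r_ge_2 by (intro proportion_ge) auto
  also have "ns j 1 \<le> msize (r - 1) (ns j)"
    unfolding msize_def using r_ge_2 by (intro member_le_sum) auto
  finally show "eps * N j \<le> real (msize (r - 1) (ns j))" by simp
  show "eps * N j \<le> real (ns j (Suc (r - 1)))" using r proportion_ge[of r j] r_ge_2 by simp
qed

lemma N_ge_1: "N j \<ge> 1"
  using msize_pos[of j] by linarith

lemma inv_var_ge: "eps\<^sup>2 / 12 * N j ^ 3 \<le> inv_var r (ns j)"
proof -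
  obtain r' where r': "r = Suc r'" "eps * N j \<le> real (msize r' (ns j))" "eps * N j \<le> real (ns j (Suc r'))"
    by (rule last_split)
  have "eps\<^sup>2 / 12 * N j ^ 3 = (eps * N j) * (eps * N j) * N j / 12"
    by (simp add: power2_eq_square power3_eq_cube)
  also have "\<dots> \<le> real (msize r' (ns j)) * real (ns j (Suc r')) * (real (msize r' (ns j)) + real (ns j (Suc r')) + 1) / 12"
    using r' eps_pos N_ge_1[of j] by (intro divide_right_mono mult_mono) (auto simp: msize_Suc)
  also have "\<dots> \<le> inv_var r (ns j)"
    using inv_var_nonneg[of r' "ns j"] by (simp add: r')
  finally show ?thesis .
qed

lemma inv_var_pos: "inv_var r (ns j) > 0"
proof -
  have "0 < eps\<^sup>2 / 12 * N j ^ 3" using eps_pos msize_pos[of j] by simp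
  then show ?thesis using inv_var_ge[of j] by linarith
qed

lemma \<sigma>_pos: "\<sigma> j > 0" and \<sigma>_square: "(\<sigma> j)\<^sup>2 = inv_var r (ns j)"
  using inv_var_pos[of j] by (auto simp: \<sigma>_def)

lemma \<sigma>_le: "\<sigma> j \<le> N j ^ 2"
proof (rule power2_le_imp_le)
  have "(\<sigma> j)\<^sup>2 \<le> N j ^ 3" unfolding \<sigma>_square by (rule inv_var_le)
  also have "\<dots> \<le> N j ^ 4" using N_ge_1[of j] by (intro power_increasing) auto
  finally show "(\<sigma> j)\<^sup>2 \<le> (N j ^ 2)\<^sup>2" by simp
qed auto

lemma N_at_top: "filterlim N at_top sequentially"
  by (rule filterlim_compose[OF filterlim_real_sequentially msize_at_top])

lemma \<sigma>_ge: "eps / 4 * sqrt (N j) \<le> \<sigma> j"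
proof (rule power2_le_imp_le)
  have "(eps / 4 * sqrt (N j))\<^sup>2 = eps\<^sup>2 / 16 * N j ^ 1" by (simp add: power_mult_distrib power_divide)
  also have "\<dots> \<le> eps\<^sup>2 / 12 * N j ^ 3"
    using N_ge_1[of j] by (intro mult_mono power_increasing divide_left_mono) auto
  also have "\<dots> \<le> (\<sigma> j)\<^sup>2" unfolding \<sigma>_square by (rule inv_var_ge)
  finally show "(eps / 4 * sqrt (N j))\<^sup>2 \<le> (\<sigma> j)\<^sup>2" .
qed (use \<sigma>_pos in \<open>auto intro: less_imp_le\<close>)

lemma \<sigma>_at_top: "filterlim \<sigma> at_top sequentially"
proof (rule filterlim_at_top_mono)
  show "filterlim (\<lambda>j. eps / 4 * sqrt (N j)) at_top sequentially"
    using eps_pos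
    by (intro filterlim_tendsto_pos_mult_at_top[OF tendsto_const]
        filterlim_compose[OF sqrt_at_top N_at_top]) auto
qed (rule always_eventually, rule allI, rule \<sigma>_ge)

text \<open>\<open>(\<sigma> j)\<^sup>2\<close> has order \<open>N j ^ 3\<close>, so for fixed
  \<open>t\<close> the quantity is of order \<open>N j ^ 5 / N j ^ 6\<close>. The constant 144 is
  the square of the 12 in the variance bound.\<close>

lemma fourth_order_error: "(\<lambda>j. N j * (N j * (t / \<sigma> j)) ^ 4) \<longlonglongrightarrow> 0"
proof (rule Lim_null_comparison)
  have "norm (N j * (N j * (t / \<sigma> j)) ^ 4) \<le> (144 * t ^ 4 / eps ^ 4) * (1 / N j)" for j
  proof -
    have "(eps\<^sup>2 / 12 * N j ^ 3)\<^sup>2 \<le> ((\<sigma> j)\<^sup>2)\<^sup>2"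
      unfolding \<sigma>_square using eps_pos by (intro power_mono inv_var_ge) auto
    then have *: "eps ^ 4 / 144 * N j ^ 6 \<le> \<sigma> j ^ 4"
      by (simp add: power_mult_distrib power_divide flip: power_mult)
    have pos: "0 < eps ^ 4 / 144 * N j ^ 6" using eps_pos msize_pos[of j] by simp
    have "norm (N j * (N j * (t / \<sigma> j)) ^ 4) = N j ^ 5 * t ^ 4 / \<sigma> j ^ 4"
      using \<sigma>_pos[of j] by (simp add: abs_mult power_mult_distrib power_divide eval_nat_numeral)
    also have "\<dots> \<le> N j ^ 5 * t ^ 4 / (eps ^ 4 / 144 * N j ^ 6)"
      using pos * mult_pos_pos[OF zero_less_power[OF \<sigma>_pos] pos] by (intro divide_left_mono) auto
    also have "\<dots> = (144 * t ^ 4 / eps ^ 4) * (1 / N j)"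
      using eps_pos N_ge_1[of j] by (simp add: divide_simps eval_nat_numeral)
    finally show ?thesis .
  qed
  then show "\<forall>\<^sub>F j in sequentially. norm (N j * (N j * (t / \<sigma> j)) ^ 4) \<le> (144 * t ^ 4 / eps ^ 4) * (1 / N j)"
    by simp
  have "(\<lambda>j. 1 / N j) \<longlonglongrightarrow> 0"
    by (rule real_tendsto_divide_at_top[OF tendsto_const N_at_top])
  then show "(\<lambda>j. (144 * t ^ 4 / eps ^ 4) * (1 / N j)) \<longlonglongrightarrow> 0"
    by (rule tendsto_mult_right_zero)
qed

text \<open>Places the frequency \<open>t / \<sigma> j\<close> of a fixed \<open>t\<close>
  eventually in the inner range. Since \<open>N j \<ge> 1\<close>, it follows by a fourth root from
  the preceding limit.\<close>

lemma N_div_\<sigma>_tendsto: "(\<lambda>j. N j * \<bar>t / \<sigma> j\<bar>) \<longlonglongrightarrow> 0"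
proof (rule Lim_null_comparison[OF _ tendsto_rabs_zero])
  have "(\<lambda>j. root 4 (N j * (N j * (t / \<sigma> j)) ^ 4)) \<longlonglongrightarrow> root 4 0"
    by (intro tendsto_real_root fourth_order_error)
  then show "(\<lambda>j. root 4 (N j * (N j * (t / \<sigma> j)) ^ 4)) \<longlonglongrightarrow> 0" by simp
  have "norm (N j * \<bar>t / \<sigma> j\<bar>) \<le> \<bar>root 4 (N j * (N j * (t / \<sigma> j)) ^ 4)\<bar>" for j
  proof -
    have "N j * \<bar>t / \<sigma> j\<bar> = \<bar>N j * (t / \<sigma> j)\<bar>" by (simp only: abs_mult abs_of_nat)
    then have eq: "(N j * \<bar>t / \<sigma> j\<bar>) ^ 4 = (N j * (t / \<sigma> j)) ^ 4" by (simp only: power_even_abs_numeral even_numeral)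
    have "1 * (N j * \<bar>t / \<sigma> j\<bar>) ^ 4 \<le> N j * (N j * \<bar>t / \<sigma> j\<bar>) ^ 4"
      using N_ge_1[of j] by (intro mult_right_mono) auto
    then have "root 4 ((N j * \<bar>t / \<sigma> j\<bar>) ^ 4) \<le> root 4 (N j * (N j * (t / \<sigma> j)) ^ 4)"
      unfolding eq by (intro real_root_le_mono) auto
    moreover have "root 4 ((N j * \<bar>t / \<sigma> j\<bar>) ^ 4) = N j * \<bar>t / \<sigma> j\<bar>"
      by (intro real_root_power_cancel) auto
    ultimately show ?thesis by (simp only: real_norm_def abs_mult abs_of_nat abs_abs)
  qed
  then show "\<forall>\<^sub>F j in sequentially. norm (N j * \<bar>t / \<sigma> j\<bar>) \<le> \<bar>root 4 (N j * (N j * (t / \<sigma> j)) ^ 4)\<bar>"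
    by simp
qed

definition "normalized_char j t = qmult_char r (ns j) (t / \<sigma> j) / T j"

lemma norm_normalized_char_inner:
  assumes "N j * \<bar>t / \<sigma> j\<bar> < 2 * pi"
  shows "norm (normalized_char j t) \<le> exp (- t\<^sup>2 / 2)"
proof -
  obtain B where B: "qmult_char r (ns j) (t / \<sigma> j) = of_real (T j * B) * cis (\<mu> j * (t / \<sigma> j))"
    "0 < B" "B \<le> exp (- inv_var r (ns j) * (t / \<sigma> j)\<^sup>2 / 2)"
    using qmult_char_inner[OF assms] by blast
  have "norm (normalized_char j t) = B"
    using B(2) mcount_pos[of r "ns j"] unfolding normalized_char_def B(1)
    by (simp add: norm_mult norm_divide)
  also have "\<dots> \<le> exp (- t\<^sup>2 / 2)"
    using B(3) inv_var_pos[of j] by (simp add: power_divide \<sigma>_square)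
  finally show ?thesis .
qed

lemma norm_normalized_char_outer:
  assumes "2 * pi \<le> N j * \<bar>t / \<sigma> j\<bar>" "\<bar>t / \<sigma> j\<bar> \<le> pi"
  shows "norm (normalized_char j t) \<le> (N j + 1) * exp (- (eps\<^sup>2 / 2) * N j)"
proof -
  obtain r' where r': "r = Suc r'" "eps * N j \<le> real (msize r' (ns j))" "eps * N j \<le> real (ns j (Suc r'))"
    by (rule last_split)
  have "2 * pi / real (msize (Suc r') (ns j)) \<le> \<bar>t / \<sigma> j\<bar>"
    using assms(1) msize_pos[of j] unfolding r' by (simp add: field_simps)
  with assms(2) msize_pos[of j] have
    "norm (qmult_char r (ns j) (t / \<sigma> j)) \<le> T j * ((N j + 1)
      * exp (- (real (msize r' (ns j)) * real (ns j (Suc r')) / (2 * N j))))"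
    unfolding r'(1) by (intro norm_qmult_char_outer) auto
  also have "\<dots> \<le> T j * ((N j + 1) * exp (- (eps\<^sup>2 / 2) * N j))"
  proof -
    have "(eps * N j) * (eps * N j) / (2 * N j) \<le> real (msize r' (ns j)) * real (ns j (Suc r')) / (2 * N j)"
      using r' eps_pos N_ge_1[of j] by (intro divide_right_mono mult_mono) auto
    moreover have "(eps * N j) * (eps * N j) / (2 * N j) = eps\<^sup>2 / 2 * N j"
      using msize_pos[of j] by (simp add: power2_eq_square)
    ultimately show ?thesis
      using mcount_pos[of r "ns j"] by (intro mult_left_mono) auto
  qed
  finally show ?thesis
    using mcount_pos[of r "ns j"] by (simp add: normalized_char_def norm_divide field_simps)
qed

text \<open>Centring removes the phase; eventually what remains is a real number squeezed between
  \<open>exp (- t\<^sup>2 / 2 - E j)\<close> and \<open>exp (- t\<^sup>2 / 2)\<close>.\<close>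

lemma normalized_char_tendsto:
  "(\<lambda>j. normalized_char j t * cis (- (\<mu> j * (t / \<sigma> j)))) \<longlonglongrightarrow> of_real (exp (- t\<^sup>2 / 2))"
proof -
  define E where "E = (\<lambda>j. N j * (N j * (t / \<sigma> j)) ^ 4)"
  have "eventually (\<lambda>j. N j * \<bar>t / \<sigma> j\<bar> < 2) sequentially"
    by (rule order_tendstoD[OF N_div_\<sigma>_tendsto]) simp
  then have ev: "eventually (\<lambda>j. \<exists>B. normalized_char j t * cis (- (\<mu> j * (t / \<sigma> j))) = complex_of_real B \<and>
      exp (- t\<^sup>2 / 2 - E j) \<le> B \<and> B \<le> exp (- t\<^sup>2 / 2)) sequentially"
  proof eventually_elim
    case (elim j)
    then have "N j * \<bar>t / \<sigma> j\<bar> < 2 * pi" "N j * \<bar>t / \<sigma> j\<bar> \<le> 2" using pi_ge_two by linarith+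
    then obtain B where B: "qmult_char r (ns j) (t / \<sigma> j) = of_real (T j * B) * cis (\<mu> j * (t / \<sigma> j))"
      "B \<le> exp (- inv_var r (ns j) * (t / \<sigma> j)\<^sup>2 / 2)"
      "exp (- inv_var r (ns j) * (t / \<sigma> j)\<^sup>2 / 2 - E j) \<le> B"
      using qmult_char_inner[of r "ns j" "t / \<sigma> j"] unfolding E_def by blast
    have "inv_var r (ns j) * (t / \<sigma> j)\<^sup>2 = t\<^sup>2"
      using inv_var_pos[of j] by (simp add: power_divide \<sigma>_square)
    moreover have "normalized_char j t * cis (- (\<mu> j * (t / \<sigma> j))) = complex_of_real B"
      using mcount_pos[of r "ns j"] unfolding normalized_char_def B(1) by (simp add: cis_mult)
    ultimately show ?case using B(2,3) by (intro exI[of _ B]) simp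
  qed
  then have bound: "eventually (\<lambda>j. norm (normalized_char j t * cis (- (\<mu> j * (t / \<sigma> j))) - of_real (exp (- t\<^sup>2 / 2)))
      \<le> exp (- t\<^sup>2 / 2) - exp (- t\<^sup>2 / 2 - E j)) sequentially"
  proof eventually_elim
    case (elim j)
    then obtain B where "normalized_char j t * cis (- (\<mu> j * (t / \<sigma> j))) = complex_of_real B"
      "exp (- t\<^sup>2 / 2 - E j) \<le> B" "B \<le> exp (- t\<^sup>2 / 2)" by blast
    then show ?case by (simp add: norm_of_real flip: of_real_diff)
  qed
  have "(\<lambda>j. exp (- t\<^sup>2 / 2) - exp (- t\<^sup>2 / 2 - E j)) \<longlonglongrightarrow> exp (- t\<^sup>2 / 2) - exp (- t\<^sup>2 / 2 - 0)"
    unfolding E_def by (intro tendsto_intros fourth_order_error)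
  then have "(\<lambda>j. exp (- t\<^sup>2 / 2) - exp (- t\<^sup>2 / 2 - E j)) \<longlonglongrightarrow> 0" by (simp only: diff_zero diff_self)
  from LIM_zero_cancel[OF Lim_null_comparison[OF bound this]] show ?thesis .
qed

theorem local_limit:
  assumes x: "(\<lambda>j. (real_of_int (m j) - \<mu> j) / \<sigma> j) \<longlonglongrightarrow> x"
  shows "(\<lambda>j. \<sigma> j ^ Suc i * (fdiff ^^ i) (qmult_coeff r (ns j)) (m j) / T j) \<longlonglongrightarrow> hermite_density i x"
proof -
  \<comment> \<open>The inversion integrand at frequency \<open>t / \<sigma> j\<close>. The Jacobian
    takes one factor \<open>\<sigma> j\<close>; the other \<open>i\<close> go to the difference
    factors, which then tend to \<open>- \<i> * t\<close>.\<close>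
  define s where "s = (\<lambda>j t. indicator {- pi..pi} (t / \<sigma> j) *\<^sub>R
     (normalized_char j t * cis (- of_int (m j) * (t / \<sigma> j)) * (of_real (\<sigma> j) * (cis (- (t / \<sigma> j)) - 1)) ^ i))"
  have s_integral: "has_bochner_integral lborel (s j)
     (of_real (2 * pi * (\<sigma> j ^ Suc i * (fdiff ^^ i) (qmult_coeff r (ns j)) (m j) / T j)))" for j
  proof -
    let ?f = "\<lambda>x. indicator {- pi..pi} x *\<^sub>R (qmult_char r (ns j) x * cis (- of_int (m j) * x) * (cis (- x) - 1) ^ i)"
    let ?v = "complex_of_real (2 * pi * (fdiff ^^ i) (qmult_coeff r (ns j)) (m j))"
    have "has_bochner_integral lborel (\<lambda>x. ?f (0 + 1 / \<sigma> j * x)) (?v /\<^sub>R \<bar>1 / \<sigma> j\<bar>)"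
      using has_bochner_integral_fdiff_qmult_coeff[of r "ns j" "m j" i] \<sigma>_pos[of j]
      by (subst lborel_has_bochner_integral_real_affine_iff[symmetric]) auto
    then have "has_bochner_integral lborel (\<lambda>x. of_real (\<sigma> j ^ i / T j) * ?f (0 + 1 / \<sigma> j * x))
        (of_real (\<sigma> j ^ i / T j) * (?v /\<^sub>R \<bar>1 / \<sigma> j\<bar>))"
      by (rule has_bochner_integral_mult_right) 
    also have "(\<lambda>x. of_real (\<sigma> j ^ i / T j) * ?f (0 + 1 / \<sigma> j * x)) = s j"
      by (simp add: s_def normalized_char_def fun_eq_iff power_mult_distrib scaleR_conv_of_real)
    also have "of_real (\<sigma> j ^ i / T j) * (?v /\<^sub>R \<bar>1 / \<sigma> j\<bar>) =
        of_real (2 * pi * (\<sigma> j ^ Suc i * (fdiff ^^ i) (qmult_coeff r (ns j)) (m j) / T j))"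
      using \<sigma>_pos[of j] by (simp add: scaleR_conv_of_real)
    finally show ?thesis .
  qed
  obtain K where K: "\<And>n::nat. (pi * real n ^ 2) ^ i * (1 + (pi * real n ^ 2)\<^sup>2) * ((real n + 1) * exp (- (eps\<^sup>2 / 2) * real n)) \<le> K"
    using exp_decay_bound[of "eps\<^sup>2 / 2" i] eps_pos by auto
  have factor: "norm (of_real (\<sigma> j) * (cis (- (t / \<sigma> j)) - 1)) \<le> \<bar>t\<bar>" for j t
  proof -
    have "norm (of_real (\<sigma> j) * (cis (- (t / \<sigma> j)) - 1)) = \<sigma> j * norm (cis (- (t / \<sigma> j)) - 1)"
      using \<sigma>_pos[of j] by (simp add: norm_mult)
    also have "\<dots> \<le> \<sigma> j * \<bar>- (t / \<sigma> j)\<bar>"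
      using \<sigma>_pos[of j] by (intro mult_left_mono norm_cis_minus_1_le) auto
    also have "\<dots> = \<bar>t\<bar>" using \<sigma>_pos[of j] by simp
    finally show ?thesis .
  qed
  have s_bound: "norm (s j t) \<le> \<bar>t\<bar> ^ i * exp (- t\<^sup>2 / 2) + K * (1 / (1 + t\<^sup>2))" for j t
  proof -
    have K0: "K \<ge> 0" using order_trans[OF _ K[of 0]] by (simp add: zero_le_power)
    have w: "0 \<le> \<bar>t\<bar> ^ i * exp (- t\<^sup>2 / 2)" "0 \<le> K * (1 / (1 + t\<^sup>2))" using K0 by auto
    have st: "norm (s j t) \<le> norm (normalized_char j t) * \<bar>t\<bar> ^ i"
      unfolding s_def using factor[of j t]
      by (auto simp: norm_mult norm_power split: split_indicator intro!: mult_left_mono power_mono)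
    \<comment> \<open>Beyond one period the integrand is 0, and in the inner range the Gaussian
      bound applies. In between the decay is exponential in \<open>N j\<close>, and
      \<open>\<bar>t\<bar>\<close> is at most \<open>pi * N j ^ 2\<close>.\<close>
    consider "\<bar>t / \<sigma> j\<bar> > pi" | "N j * \<bar>t / \<sigma> j\<bar> < 2 * pi" | "\<bar>t / \<sigma> j\<bar> \<le> pi" "2 * pi \<le> N j * \<bar>t / \<sigma> j\<bar>"
      by linarith
    then show ?thesis
    proof cases
      case 1
      then have "s j t = 0" unfolding s_def by (auto simp: indicator_def abs_le_iff)
      then show ?thesis using w by simp
    next
      case 2
      have "norm (normalized_char j t) * \<bar>t\<bar> ^ i \<le> exp (- t\<^sup>2 / 2) * \<bar>t\<bar> ^ i"
        by (intro mult_right_mono norm_normalized_char_inner 2) auto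
      with st w show ?thesis by (simp add: mult.commute)
    next
      case 3
      have "\<bar>t\<bar> = \<sigma> j * \<bar>t / \<sigma> j\<bar>" using \<sigma>_pos[of j] by simp
      also have "\<dots> \<le> N j ^ 2 * pi" using 3 \<sigma>_pos[of j] \<sigma>_le[of j] by (intro mult_mono) auto
      finally have t: "\<bar>t\<bar> \<le> pi * N j ^ 2" by (simp add: mult.commute)
      then have t2: "t\<^sup>2 \<le> (pi * N j ^ 2)\<^sup>2"
        by (simp add: abs_le_square_iff[symmetric])
      have "norm (normalized_char j t) * \<bar>t\<bar> ^ i \<le> ((N j + 1) * exp (- (eps\<^sup>2 / 2) * N j)) * (pi * N j ^ 2) ^ i"
        using t by (intro mult_mono norm_normalized_char_outer[OF 3(2,1)] power_mono) auto
      moreover have "((N j + 1) * exp (- (eps\<^sup>2 / 2) * N j)) * (pi * N j ^ 2) ^ i * (1 + t\<^sup>2)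
          \<le> ((N j + 1) * exp (- (eps\<^sup>2 / 2) * N j)) * (pi * N j ^ 2) ^ i * (1 + (pi * N j ^ 2)\<^sup>2)"
        using t2 by (intro mult_left_mono) auto
      moreover have "\<dots> \<le> K" using K[of "msize r (ns j)"] by (simp add: mult_ac)
      ultimately have "norm (normalized_char j t) * \<bar>t\<bar> ^ i * (1 + t\<^sup>2) \<le> K"
        by (meson mult_right_mono order_trans add_nonneg_nonneg zero_le_one zero_le_power2)
      then have "norm (normalized_char j t) * \<bar>t\<bar> ^ i \<le> K * (1 / (1 + t\<^sup>2))"
        by (simp add: pos_le_divide_eq add_pos_nonneg)
      with st w show ?thesis by linarith
    qed
  qed
  have s_tendsto: "(\<lambda>j. s j t) \<longlonglongrightarrow> gauss_moment i x t" for t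
  proof -
    have 1: "(\<lambda>j. normalized_char j t * cis (- (\<mu> j * (t / \<sigma> j)))) \<longlonglongrightarrow> of_real (exp (- t\<^sup>2 / 2))"
      by (rule normalized_char_tendsto)
    have 2: "(\<lambda>j. cis (- ((real_of_int (m j) - \<mu> j) / \<sigma> j) * t)) \<longlonglongrightarrow> cis (- x * t)"
      unfolding cis_conv_exp by (intro tendsto_intros x)
    have inv: "(\<lambda>j. 1 / \<sigma> j) \<longlonglongrightarrow> 0"
      by (rule real_tendsto_divide_at_top[OF tendsto_const \<sigma>_at_top])
    have 3: "(\<lambda>j. ((cis (1 / \<sigma> j * (- t)) - 1) / of_real (1 / \<sigma> j)) ^ i) \<longlonglongrightarrow> (\<i> * of_real (- t)) ^ i"
      using \<sigma>_pos by (intro tendsto_power cis_difference_quotient_tendsto inv) (auto simp: less_imp_neq[THEN not_sym])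
    have lim: "(\<lambda>j. (normalized_char j t * cis (- (\<mu> j * (t / \<sigma> j)))) * cis (- ((real_of_int (m j) - \<mu> j) / \<sigma> j) * t)
        * ((cis (1 / \<sigma> j * (- t)) - 1) / of_real (1 / \<sigma> j)) ^ i) \<longlonglongrightarrow> gauss_moment i x t"
      using tendsto_mult[OF tendsto_mult[OF 1 2] 3] by (simp add: gauss_moment_def)
    have "(\<lambda>j. \<bar>t / \<sigma> j\<bar>) \<longlonglongrightarrow> 0"
      using tendsto_rabs_zero[OF tendsto_mult_right_zero[OF inv, of t]] by simp
    then have "eventually (\<lambda>j. \<bar>t / \<sigma> j\<bar> < pi) sequentially"
      by (rule order_tendstoD) simp
    then have "eventually (\<lambda>j. (normalized_char j t * cis (- (\<mu> j * (t / \<sigma> j)))) * cis (- ((real_of_int (m j) - \<mu> j) / \<sigma> j) * t)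
        * ((cis (1 / \<sigma> j * (- t)) - 1) / of_real (1 / \<sigma> j)) ^ i = s j t) sequentially"
    proof eventually_elim
      case (elim j)
      have "cis (- (\<mu> j * (t / \<sigma> j))) * cis (- ((real_of_int (m j) - \<mu> j) / \<sigma> j) * t) = cis (- of_int (m j) * (t / \<sigma> j))"
        unfolding cis_mult by (rule arg_cong[of _ _ cis]) (simp add: algebra_simps diff_divide_distrib)
      moreover have "indicator {- pi..pi} (t / \<sigma> j) = (1::real)" using elim unfolding abs_less_iff by (auto simp: indicator_def)
      moreover have "(cis (1 / \<sigma> j * (- t)) - 1) / of_real (1 / \<sigma> j) = of_real (\<sigma> j) * (cis (- (t / \<sigma> j)) - 1)"
        using \<sigma>_pos[of j] by simp
      ultimately show ?case unfolding s_def by (simp only: mult.assoc scaleR_one)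
    qed
    from Lim_transform_eventually[OF lim this] show ?thesis .
  qed
  have "(\<lambda>j. integral\<^sup>L lborel (s j)) \<longlonglongrightarrow> integral\<^sup>L lborel (gauss_moment i x)"
  proof (rule integral_dominated_convergence)
    show "integrable lborel (\<lambda>t. \<bar>t\<bar> ^ i * exp (- t\<^sup>2 / 2) + K * (1 / (1 + t\<^sup>2)))"
      by (intro Bochner_Integration.integrable_add integrable_gauss_abs_moment integrable_mult_right
          integrable_inverse_1_plus_square_real)
    show "s j \<in> borel_measurable lborel" for j
      using s_integral[of j] by (auto simp: has_bochner_integral_iff)
    show "AE t in lborel. (\<lambda>j. s j t) \<longlonglongrightarrow> gauss_moment i x t" using s_tendsto by simp
    show "AE t in lborel. norm (s j t) \<le> \<bar>t\<bar> ^ i * exp (- t\<^sup>2 / 2) + K * (1 / (1 + t\<^sup>2))" for j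
      using s_bound by simp
  qed auto
  then have "(\<lambda>j. 2 * pi * (\<sigma> j ^ Suc i * (fdiff ^^ i) (qmult_coeff r (ns j)) (m j) / T j)) \<longlonglongrightarrow> 2 * pi * hermite_density i x"
    unfolding has_bochner_integral_integral_eq[OF s_integral] integral_gauss_moment tendsto_of_real_iff .
  from tendsto_mult[OF tendsto_const[of "1 / (2 * pi)"] this] show ?thesis by simp
qed

text \<open>Stated for all \<open>i\<close>, since unfolding one order of \<open>smooth_conv\<close>
  passes from \<open>i\<close> to \<open>i + 1\<close>.\<close>

lemma smooth_conv_fdiff_qmult_coeff:
  "smooth_conv \<mu> \<sigma> n (\<lambda>j. (fdiff ^^ i) (qmult_coeff r (ns j))) (\<lambda>j. T j / \<sigma> j ^ Suc i) (hermite_density i)"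
proof (induction n arbitrary: i)
  case 0
  show ?case using local_limit by (simp add: mult.commute)
next
  case (Suc n)
  have "(\<lambda>j. (fdiff ^^ i) (qmult_coeff r (ns j)) (m j) / (T j / \<sigma> j ^ Suc i)) \<longlonglongrightarrow> hermite_density i x"
    if "(\<lambda>j. (real_of_int (m j) - \<mu> j) / \<sigma> j) \<longlonglongrightarrow> x" for m x
    using local_limit[OF that] by (simp add: mult.commute)
  moreover have "smooth_conv \<mu> \<sigma> n (\<lambda>j. fdiff ((fdiff ^^ i) (qmult_coeff r (ns j)))) (\<lambda>j. T j / \<sigma> j ^ Suc i / \<sigma> j) (hermite_density (Suc i))"
    using Suc.IH[of "Suc i"] by (simp add: mult_ac)
  ultimately show ?case by (intro smooth_conv_SucI[OF _ hermite_density_has_deriv])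
qed

lemma smooth_conv_qmult_coeff:
  "smooth_conv \<mu> \<sigma> n (\<lambda>j. qmult_coeff r (ns j)) (\<lambda>j. T j / \<sigma> j) std_normal_density"
proof -
  have "hermite_density 0 = std_normal_density" by (simp add: hermite_density_def fun_eq_iff)
  then show ?thesis using smooth_conv_fdiff_qmult_coeff[of n 0] by simp
qed

end

section \<open>Jensen polynomials and iterated Turan operators\<close>

lemma poly_jensen: "poly (jensen d m u) y = (\<Sum>j\<le>d. real (d choose j) * u (m + int j) * y ^ j)"
  by (simp add: jensen_def poly_sum poly_monom atMost_atLeast0)

lemma degree_jensen_le: "degree (jensen d m u) \<le> d"
  unfolding jensen_def by (intro degree_sum_le) (auto intro: order_trans[OF degree_monom_le])

text \<open>Pascal's rule for the weights: raising the degree applies the factor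
  \<open>1 + y * E\<close>, with \<open>E\<close> the shift of the index.\<close>

lemma poly_jensen_Suc: "poly (jensen (Suc d) m u) y = poly (jensen d m u) y + y * poly (jensen d (m + 1) u) y"
proof -
  have "poly (jensen (Suc d) m u) y = u m + (\<Sum>j\<le>d. real (Suc d choose Suc j) * u (m + int (Suc j)) * y ^ Suc j)"
    unfolding poly_jensen by (subst sum.atMost_Suc_shift) simp
  also have "\<dots> = (u m + (\<Sum>j\<le>d. real (d choose Suc j) * u (m + int (Suc j)) * y ^ Suc j))
      + (\<Sum>j\<le>d. real (d choose j) * u (m + int (Suc j)) * y ^ Suc j)"
    by (simp add: sum.distrib[symmetric] algebra_simps)
  also have "u m + (\<Sum>j\<le>d. real (d choose Suc j) * u (m + int (Suc j)) * y ^ Suc j)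
      = (\<Sum>j\<le>Suc d. real (d choose j) * u (m + int j) * y ^ j)"
    by (subst sum.atMost_Suc_shift) simp
  also have "\<dots> = poly (jensen d m u) y"
    unfolding poly_jensen by simp
  also have "(\<Sum>j\<le>d. real (d choose j) * u (m + int (Suc j)) * y ^ Suc j) = y * poly (jensen d (m + 1) u) y"
    unfolding poly_jensen by (simp add: sum_distrib_left algebra_simps)
  finally show ?thesis .
qed

lemma real_rooted_smultD: "real_rooted (smult c p) \<Longrightarrow> real_rooted p"
  using cpoly_smult[of c p] by (auto simp: real_rooted_def cpoly_def)

lemma cpoly_pcompose_linear: "cpoly (p \<circ>\<^sub>p [:a, b:]) z = cpoly p (of_real a + of_real b * z)"
  by (induction p) (simp_all add: pcompose_pCons cpoly_add cpoly_mult cpoly_smult cpoly_pCons algebra_simps)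

lemma real_rooted_affine:
  assumes "real_rooted p" "b \<noteq> 0" "c \<noteq> 0"
  shows "real_rooted (smult c (p \<circ>\<^sub>p [:a, b:]))"
  unfolding real_rooted_def cpoly_def[symmetric]
proof (intro allI impI)
  fix z assume "cpoly (smult c (p \<circ>\<^sub>p [:a, b:])) z = 0"
  then have "cpoly p (of_real a + of_real b * z) = 0"
    using assms(3) by (simp add: cpoly_smult cpoly_pcompose_linear)
  then have "of_real a + of_real b * z \<in> \<real>"
    using assms(1) by (auto simp: real_rooted_def cpoly_def)
  then have "(of_real a + of_real b * z - of_real a) / of_real b \<in> \<real>"
    by (intro Reals_divide Reals_diff) auto
  then show "z \<in> \<real>" using assms(2) by simp
qed

lemma qmult_var_pos:
  assumes "r \<ge> 2" "\<And>i. i \<in> {1..r} \<Longrightarrow> ns i > 0"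
  shows "qmult_var r ns > 0"
proof -
  have "0 < (\<Sum>j\<in>{1<..r}. real (ns 1) * real (ns j) * (real (ns 1) + real (ns j) + 1))"
    using assms assms(2)[of 1] assms(2)[of 2] by (intro sum_pos2[of _ 2]) auto
  then have "0 < (\<Sum>i=1..r. \<Sum>j\<in>{i<..r}. real (ns i) * real (ns j) * (real (ns i) + real (ns j) + 1))"
  proof (rule sum_pos2[where i = 1, rotated 2])
    show "1 \<in> {1..r}" using assms by simp
  qed (auto intro!: sum_nonneg)
  then show ?thesis by (simp add: qmult_var_def)
qed

text \<open>Expanding \<open>1 + E * (- 1 + y / \<sigma>)\<close>, with \<open>E\<close> the shift, shows that the Jensen polynomial at \<open>- 1 + y / \<sigma>\<close> is,
  up to \<open>\<sigma> ^ d\<close>, the \<open>d\<close>-th iterate of \<open>y * E - \<sigma> * \<Delta>\<close>.\<close>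

primrec jensen_step :: "(nat \<Rightarrow> real) \<Rightarrow> real \<Rightarrow> nat \<Rightarrow> (nat \<Rightarrow> int \<Rightarrow> real) \<Rightarrow> nat \<Rightarrow> int \<Rightarrow> real" where
  "jensen_step \<sigma> y 0 u j k = u j k"
| "jensen_step \<sigma> y (Suc d) u j k =
     y * jensen_step \<sigma> y d u j (k + 1) + (- 1) * (\<sigma> j * fdiff (jensen_step \<sigma> y d u j) k)"

lemma jensen_step_eq:
  assumes "\<sigma> j \<noteq> 0"
  shows "jensen_step \<sigma> y d u j k = \<sigma> j ^ d * poly (jensen d k (u j)) (- 1 + y / \<sigma> j)"
proof (induction d arbitrary: k)
  case 0
  show ?case by (simp add: poly_jensen)
next
  case (Suc d)
  show ?case using assms
    by (simp add: Suc.IH poly_jensen_Suc fdiff_def field_simps)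
qed

context qmult_sequence
begin

text \<open>The shifted term contributes \<open>y * hermite d\<close> and the difference
  \<open>hermite (Suc d) - y * hermite d\<close>, each at \<open>x + y\<close> and times the
  density, so the terms with factor \<open>y\<close> cancel. The order \<open>n\<close> varies in
  the induction because each step uses up one.\<close>

lemma smooth_conv_jensen_step:
  "smooth_conv \<mu> \<sigma> n (jensen_step \<sigma> y d (\<lambda>j. qmult_coeff r (ns j))) (\<lambda>j. T j / \<sigma> j)
     (\<lambda>x. poly (hermite d) (x + y) * std_normal_density x)"
proof (induction d arbitrary: n)
  case 0
  have "jensen_step \<sigma> y 0 (\<lambda>j. qmult_coeff r (ns j)) = (\<lambda>j. qmult_coeff r (ns j))"
    by (simp add: fun_eq_iff)
  then show ?case using smooth_conv_qmult_coeff by simp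
next
  case (Suc d)
  let ?u = "jensen_step \<sigma> y d (\<lambda>j. qmult_coeff r (ns j))"
  have nz: "\<sigma> j \<noteq> 0" for j using \<sigma>_pos[of j] by simp
  have "smooth_conv \<mu> \<sigma> n (\<lambda>j k. \<sigma> j * fdiff (?u j) k) (\<lambda>j. \<sigma> j * (T j / \<sigma> j / \<sigma> j))
     (\<lambda>x. y * (poly (hermite d) (x + y) * std_normal_density x) - poly (hermite (Suc d)) (x + y) * std_normal_density x)"
    by (rule smooth_conv_rescale[OF smooth_conv_fdiff[OF Suc.IH hermite_density_deriv] \<sigma>_pos])
  then have 1: "smooth_conv \<mu> \<sigma> n (\<lambda>j k. \<sigma> j * fdiff (?u j) k) (\<lambda>j. T j / \<sigma> j)
     (\<lambda>x. y * (poly (hermite d) (x + y) * std_normal_density x) - poly (hermite (Suc d)) (x + y) * std_normal_density x)"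
    by (simp add: nz)
  have 2: "smooth_conv \<mu> \<sigma> n (\<lambda>j k. y * ?u j (k + 1)) (\<lambda>j. T j / \<sigma> j)
     (\<lambda>x. y * (poly (hermite d) (x + y) * std_normal_density x))"
    by (intro smooth_conv_cmult smooth_conv_shift \<sigma>_at_top Suc.IH)
  have "jensen_step \<sigma> y (Suc d) (\<lambda>j. qmult_coeff r (ns j)) =
      (\<lambda>j k. y * ?u j (k + 1) + (- 1) * (\<sigma> j * fdiff (?u j) k))"
    by (simp add: fun_eq_iff)
  with smooth_conv_add[OF 2 smooth_conv_cmult[OF 1, of "- 1"]] show ?case
    by simp
qed

text \<open>At the test point \<open>- 1 + (a i - x) / \<sigma> j\<close> the rescaled polynomial
  tends to a positive multiple of \<open>hermite d\<close> at its alternation point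
  \<open>a i\<close>. Finitely many signs agree eventually, and the degree bound does the
  rest.\<close>

lemma eventually_real_rooted_jensen:
  assumes x: "(\<lambda>j. (real_of_int (m j) - \<mu> j) / \<sigma> j) \<longlonglongrightarrow> x"
  shows "eventually (\<lambda>j. real_rooted (jensen d (m j) (qmult_coeff r (ns j)))) sequentially"
proof -
  obtain a where a: "\<And>i. i < d \<Longrightarrow> a i < a (Suc i)"
      "\<And>i. i \<le> d \<Longrightarrow> 0 < (- 1) ^ i * ((- 1) ^ d * poly (hermite d) (a i))"
    using alternates_hermite[of d] by (auto simp: alternates_def)
  have "eventually (\<lambda>j. 0 < (- 1) ^ i * poly (smult ((- 1) ^ d) (jensen d (m j) (qmult_coeff r (ns j)))) (- 1 + (a i - x) / \<sigma> j)) sequentially"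
    if i: "i \<le> d" for i
  proof -
    have "(\<lambda>j. jensen_step \<sigma> (a i - x) d (\<lambda>j. qmult_coeff r (ns j)) j (m j) / (T j / \<sigma> j))
        \<longlonglongrightarrow> poly (hermite d) (x + (a i - x)) * std_normal_density x"
      by (rule smooth_conv_tendsto[OF smooth_conv_jensen_step[of 0] x])
    then have "(\<lambda>j. (- 1) ^ i * (- 1) ^ d * (jensen_step \<sigma> (a i - x) d (\<lambda>j. qmult_coeff r (ns j)) j (m j) / (T j / \<sigma> j)))
        \<longlonglongrightarrow> (- 1) ^ i * (- 1) ^ d * (poly (hermite d) (a i) * std_normal_density x)"
      by (intro tendsto_mult tendsto_const) simp
    moreover have "0 < (- 1) ^ i * (- 1) ^ d * (poly (hermite d) (a i) * std_normal_density x)"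
      using mult_pos_pos[OF a(2)[OF i] normal_density_pos[of 1 0 x]] by (simp add: mult.assoc)
    ultimately have "eventually (\<lambda>j. 0 < (- 1) ^ i * (- 1) ^ d *
        (jensen_step \<sigma> (a i - x) d (\<lambda>j. qmult_coeff r (ns j)) j (m j) / (T j / \<sigma> j))) sequentially"
      by (rule order_tendstoD)
    then show ?thesis
    proof eventually_elim
      case (elim j)
      have "\<sigma> j ^ d / (T j / \<sigma> j) > 0" using \<sigma>_pos[of j] mcount_pos[of r "ns j"] by simp
      moreover have "(- 1) ^ i * (- 1) ^ d * (jensen_step \<sigma> (a i - x) d (\<lambda>j. qmult_coeff r (ns j)) j (m j) / (T j / \<sigma> j))
         = (\<sigma> j ^ d / (T j / \<sigma> j)) * ((- 1) ^ i * poly (smult ((- 1) ^ d) (jensen d (m j) (qmult_coeff r (ns j)))) (- 1 + (a i - x) / \<sigma> j))"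
        using \<sigma>_pos[of j] by (simp add: jensen_step_eq)
      ultimately show ?case using elim zero_less_mult_pos by metis
    qed
  qed
  then have "eventually (\<lambda>j. \<forall>i\<in>{..d}. 0 < (- 1) ^ i * poly (smult ((- 1) ^ d) (jensen d (m j) (qmult_coeff r (ns j)))) (- 1 + (a i - x) / \<sigma> j)) sequentially"
    by (intro eventually_ball_finite) auto
  then show ?thesis
  proof eventually_elim
    case (elim j)
    have "alternates d (poly (smult ((- 1) ^ d) (jensen d (m j) (qmult_coeff r (ns j)))))"
      unfolding alternates_def using elim a(1) \<sigma>_pos[of j]
      by (intro exI[of _ "\<lambda>i. - 1 + (a i - x) / \<sigma> j"]) (simp add: divide_strict_right_mono)
    then have "real_rooted (smult ((- 1) ^ d) (jensen d (m j) (qmult_coeff r (ns j))))"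
      by (rule alternates_imp_real_rooted) (simp add: degree_jensen_le)
    then show ?case by (rule real_rooted_smultD)
  qed
qed

text \<open>The local limit makes the denominator \<open>qmult_coeff\<close> positive eventually;
  the scaled polynomial is then a nonzero multiple of an affine substitution.\<close>

lemma eventually_real_rooted_scaled_jensen:
  assumes x: "(\<lambda>j. (real_of_int (m j) - \<mu> j) / \<sigma> j) \<longlonglongrightarrow> x"
  shows "eventually (\<lambda>j. real_rooted (scaled_jensen d (m j) r (ns j))) sequentially"
proof -
  have "(\<lambda>j. qmult_coeff r (ns j) (m j) / (T j / \<sigma> j)) \<longlonglongrightarrow> std_normal_density x"
    by (rule smooth_conv_tendsto[OF smooth_conv_qmult_coeff[of 0] x])
  then have "eventually (\<lambda>j. 0 < qmult_coeff r (ns j) (m j) / (T j / \<sigma> j)) sequentially"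
    by (rule order_tendstoD) (simp add: normal_density_pos)
  with eventually_real_rooted_jensen[OF x, of d] show ?thesis
  proof eventually_elim
    case (elim j)
    have "ns j i > 0" if "i \<in> {1..r}" for i
    proof -
      have "0 < eps * N j" using eps_pos msize_pos[of j] by simp
      also have "\<dots> \<le> real (ns j i)" by (rule proportion_ge[OF that])
      finally show ?thesis by simp
    qed
    then have "qmult_delta r (ns j) > 0"
      using qmult_var_pos[of r "ns j"] r_ge_2 by (simp add: qmult_delta_def qmult_sd_def)
    moreover have "qmult_coeff r (ns j) (m j) \<noteq> 0" using elim(2) by auto
    ultimately show ?case
      unfolding scaled_jensen_def using elim(1) by (intro real_rooted_affine) auto
  qed
qed

text \<open>All orders \<open>n\<close> are kept at once, because each application of
  \<open>turan_op\<close> consumes two. Positivity of \<open>a\<close> is carried along because the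
  next leading coefficient is \<open>a * c\<^sup>2\<close>.\<close>

lemma smooth_conv_turan_iterate:
  "\<exists>A a c. (\<forall>j. A j > 0) \<and> a > 0 \<and> c > 0 \<and>
     (\<forall>n. smooth_conv \<mu> \<sigma> n (\<lambda>j. (turan_op ^^ s) (qmult_coeff r (ns j))) A (\<lambda>x. c * exp (- a * x\<^sup>2 / 2)))"
proof (induction s)
  case 0
  have "std_normal_density = (\<lambda>x. 1 / sqrt (2 * pi) * exp (- 1 * x\<^sup>2 / 2))"
    by (simp add: std_normal_density_def fun_eq_iff)
  moreover have "T j / \<sigma> j > 0" for j using mcount_pos[of r "ns j"] \<sigma>_pos[of j] by simp
  ultimately show ?case using smooth_conv_qmult_coeff
    by (intro exI[of _ "\<lambda>j. T j / \<sigma> j"] exI[of _ 1] exI[of _ "1 / sqrt (2 * pi)"]) auto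
next
  case (Suc s)
  then obtain A a c where IH: "\<And>j. A j > 0" "a > 0" "c > 0"
    "\<And>n. smooth_conv \<mu> \<sigma> n (\<lambda>j. (turan_op ^^ s) (qmult_coeff r (ns j))) A (\<lambda>x. c * exp (- a * x\<^sup>2 / 2))"
    by blast
  have D1: "((\<lambda>x. c * exp (- a * x\<^sup>2 / 2)) has_real_derivative - a * x * (c * exp (- a * x\<^sup>2 / 2))) (at x)" for x
    by (auto intro!: derivative_eq_intros)
  have D2: "((\<lambda>x. - a * x * (c * exp (- a * x\<^sup>2 / 2))) has_real_derivative
      (a\<^sup>2 * x\<^sup>2 - a) * (c * exp (- a * x\<^sup>2 / 2))) (at x)" for x
    by (auto intro!: derivative_eq_intros simp: power2_eq_square algebra_simps)
  have eq: "(- a * x * (c * exp (- a * x\<^sup>2 / 2)))\<^sup>2 - c * exp (- a * x\<^sup>2 / 2) * ((a\<^sup>2 * x\<^sup>2 - a) * (c * exp (- a * x\<^sup>2 / 2)))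
     = (a * c\<^sup>2) * exp (- (2 * a) * x\<^sup>2 / 2)" for x
  proof -
    define e where "e = exp (- a * x\<^sup>2 / 2)"
    have "exp (- (2 * a) * x\<^sup>2 / 2) = e\<^sup>2" by (simp add: e_def exp_double[symmetric])
    then show ?thesis unfolding e_def[symmetric] by (simp add: power2_eq_square algebra_simps)
  qed
  have "smooth_conv \<mu> \<sigma> n (\<lambda>j. (turan_op ^^ Suc s) (qmult_coeff r (ns j))) (\<lambda>j. (A j / \<sigma> j)\<^sup>2)
     (\<lambda>x. (a * c\<^sup>2) * exp (- (2 * a) * x\<^sup>2 / 2))" for n
    using smooth_conv_turan_op[OF \<sigma>_at_top IH(4) D1 D2, of n] unfolding eq by simp
  moreover have "0 < (A j / \<sigma> j)\<^sup>2" for j using IH(1)[of j] \<sigma>_pos[of j] by simp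
  ultimately show ?case using IH(2,3)
    by (intro exI[of _ "\<lambda>j. (A j / \<sigma> j)\<^sup>2"] exI[of _ "2 * a"] exI[of _ "a * c\<^sup>2"]) auto
qed

lemma eventually_turan_iterate_pos:
  assumes x: "(\<lambda>j. (real_of_int (m j) - \<mu> j) / \<sigma> j) \<longlonglongrightarrow> x"
  shows "eventually (\<lambda>j. (turan_op ^^ s) (qmult_coeff r (ns j)) (m j) > 0) sequentially"
proof -
  obtain A a c where A: "\<And>j. A j > 0" "c > 0"
    "\<And>n. smooth_conv \<mu> \<sigma> n (\<lambda>j. (turan_op ^^ s) (qmult_coeff r (ns j))) A (\<lambda>x. c * exp (- a * x\<^sup>2 / 2))"
    using smooth_conv_turan_iterate[of s] by blast
  have "eventually (\<lambda>j. 0 < (turan_op ^^ s) (qmult_coeff r (ns j)) (m j) / A j) sequentially"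
    using A(2) by (intro order_tendstoD(1)[OF smooth_conv_tendsto[OF A(3)[of 0] x]]) simp
  then show ?thesis
  proof eventually_elim
    case (elim j)
    then show ?case using A(1)[of j] by (auto simp: zero_less_divide_iff)
  qed
qed

end

section \<open>From index sequences to uniformity over the window\<close>

text \<open>A failure along \<open>F\<close> yields a sequence of failures whose normalised indices lie in a compact interval.\<close>

lemma eventually_window_if_sequentially:
  fixes F :: "'a filter" and ns :: "'a \<Rightarrow> nat \<Rightarrow> nat" and Q :: "(nat \<Rightarrow> nat) \<Rightarrow> int \<Rightarrow> bool"
  assumes "r \<ge> 2" "eps > 0"
    and large: "filterlim (\<lambda>x. msize r (ns x)) at_top F"
    and prp: "eventually (\<lambda>x. \<forall>i\<in>{1..r}. eps * real (msize r (ns x)) \<le> real (ns x i)) F"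
    and Q: "\<And>u m x. qmult_sequence r eps u \<Longrightarrow>
       (\<lambda>j. (real_of_int (m j) - qmult_mean r (u j)) / qmult_sequence.\<sigma> r u j) \<longlonglongrightarrow> x \<Longrightarrow>
       eventually (\<lambda>j. Q (u j) (m j)) sequentially"
  shows "eventually (\<lambda>x. \<forall>m\<in>window C r (ns x). Q (ns x) m) F"
proof (rule ccontr)
  assume "\<not> ?thesis"
  then have freq: "frequently (\<lambda>x. \<exists>m\<in>window C r (ns x). \<not> Q (ns x) m) F"
    by (simp add: frequently_def)
  \<comment> \<open>The bound \<open>Suc k\<close> makes the sizes of the chosen failures positive
    and drives them to infinity.\<close>
  have "\<exists>x m. m \<in> window C r (ns x) \<and> \<not> Q (ns x) m \<and> Suc k \<le> msize r (ns x) \<and>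
      (\<forall>i\<in>{1..r}. eps * real (msize r (ns x)) \<le> real (ns x i))" for k
  proof -
    have "eventually (\<lambda>x. Suc k \<le> msize r (ns x)) F"
      using large by (simp add: filterlim_at_top)
    from frequently_eventually_frequently[OF freq eventually_conj[OF this prp]]
    show ?thesis using frequently_ex by fastforce
  qed
  then obtain f m where fm: "\<And>k. m k \<in> window C r (ns (f k))" "\<And>k. \<not> Q (ns (f k)) (m k)"
    "\<And>k. Suc k \<le> msize r (ns (f k))"
    "\<And>k i. i \<in> {1..r} \<Longrightarrow> eps * real (msize r (ns (f k))) \<le> real (ns (f k) i)"
    by metis
  define y where "y = (\<lambda>k. (real_of_int (m k) - qmult_mean r (ns (f k))) / sqrt (inv_var r (ns (f k))))"
  have "y k \<in> {- \<bar>C\<bar>..\<bar>C\<bar>}" for k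
  proof -
    define S where "S = sqrt (inv_var r (ns (f k)))"
    have S: "S \<ge> 0" by (simp add: S_def inv_var_nonneg)
    have "qmult_sd r (ns (f k)) \<le> S" unfolding qmult_sd_def S_def by (simp add: qmult_var_le)
    moreover have "qmult_sd r (ns (f k)) \<ge> 0"
      by (auto simp: qmult_sd_def qmult_var_def intro!: sum_nonneg)
    ultimately have "C * qmult_sd r (ns (f k)) \<le> \<bar>C\<bar> * S" by (intro mult_mono) auto
    then have "\<bar>real_of_int (m k) - qmult_mean r (ns (f k))\<bar> \<le> \<bar>C\<bar> * S"
      using fm(1)[of k] by (simp add: window_def)
    \<comment> \<open>If \<open>S = 0\<close>, division by zero makes \<open>y k\<close> equal to
      0.\<close>
    then have "\<bar>y k\<bar> \<le> \<bar>C\<bar>"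
      using S unfolding y_def S_def[symmetric] by (cases "S = 0") (auto simp: abs_divide pos_divide_le_eq)
    then show ?thesis by (auto simp: abs_le_iff)
  qed
  then obtain x l where l: "strict_mono l" "(y \<circ> l) \<longlonglongrightarrow> x"
    using compact_Icc[of "- \<bar>C\<bar>" "\<bar>C\<bar>"] unfolding compact_eq_seq_compact_metric seq_compact_def by metis
  have "qmult_sequence r eps (\<lambda>j. ns (f (l j)))"
  proof
    show "filterlim (\<lambda>j. msize r (ns (f (l j)))) at_top sequentially"
    proof (rule filterlim_at_top_mono[OF filterlim_ident], rule always_eventually, rule allI)
      show "j \<le> msize r (ns (f (l j)))" for j
        using fm(3)[of "l j"] strict_mono_imp_increasing[OF l(1), of j] by linarith
    qed
    show "0 < msize r (ns (f (l j)))" for j using fm(3)[of "l j"] by linarith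
  qed (use assms fm in auto)
  moreover from this have "qmult_sequence.\<sigma> r (\<lambda>j. ns (f (l j))) = (\<lambda>j. sqrt (inv_var r (ns (f (l j)))))"
    by (simp add: qmult_sequence.\<sigma>_def fun_eq_iff)
  ultimately have "eventually (\<lambda>j. Q (ns (f (l j))) (m (l j))) sequentially"
    using l(2) by (intro Q[where x = x]) (auto simp: y_def comp_def)
  then show False using fm(2) by simp
qed

theorem corollary4:
  fixes d r :: nat and C eps :: real and lam :: "nat \<Rightarrow> real"
    and F :: "'a filter" and ns :: "'a \<Rightarrow> nat \<Rightarrow> nat"
  assumes "d \<ge> 1" and "r \<ge> 2" and "C > 0" and "eps > 0"
    and "\<And>i. i \<in> {1..r} \<Longrightarrow> lam i \<in> {eps<..<1 - eps}"
    and "filterlim (\<lambda>x. \<Sum>i=1..r. ns x i) at_top F"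
    and "\<And>i. i \<in> {1..r} \<Longrightarrow>
           ((\<lambda>x. real (ns x i) / real (\<Sum>l=1..r. ns x l)) \<longlongrightarrow> lam i) F"
  shows "(\<forall>\<^sub>F x in F. \<forall>m \<in> window C r (ns x). real_rooted (scaled_jensen d m r (ns x))) \<and>
         (\<forall>\<^sub>F x in F. \<forall>s \<in> {1..d}. \<forall>k \<in> window C r (ns x).
            (turan_op ^^ s) (qmult_coeff r (ns x)) k \<ge> 0)"
proof
  have large: "filterlim (\<lambda>x. msize r (ns x)) at_top F"
    using assms(6) by (simp add: msize_def)
  have "eventually (\<lambda>x. eps * real (msize r (ns x)) \<le> real (ns x i)) F" if "i \<in> {1..r}" for i
  proof -
    have "eventually (\<lambda>x. eps < real (ns x i) / real (\<Sum>l=1..r. ns x l)) F"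
      using assms(5)[OF that] by (intro order_tendstoD(1)[OF assms(7)[OF that]]) auto
    then show ?thesis
    proof eventually_elim
      case (elim x)
      \<comment> \<open>For size 0 the ratio would be 0 by the convention on division, contrary to
        \<open>eps > 0\<close>.\<close>
      have "0 < msize r (ns x)"
        using elim assms(4) unfolding msize_def by (intro gr0I) auto
      then show ?case using elim unfolding msize_def[symmetric] by (simp add: pos_less_divide_eq)
    qed
  qed
  then have prp: "eventually (\<lambda>x. \<forall>i\<in>{1..r}. eps * real (msize r (ns x)) \<le> real (ns x i)) F"
    by (intro eventually_ball_finite) auto
  note seq = eventually_window_if_sequentially[OF assms(2,4) large prp]
  show "\<forall>\<^sub>F x in F. \<forall>m \<in> window C r (ns x). real_rooted (scaled_jensen d m r (ns x))"
    by (rule seq[where Q = "\<lambda>u m. real_rooted (scaled_jensen d m r u)"])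
       (rule qmult_sequence.eventually_real_rooted_scaled_jensen)
  have "\<forall>\<^sub>F x in F. \<forall>k \<in> window C r (ns x). (turan_op ^^ s) (qmult_coeff r (ns x)) k > 0" for s
    by (rule seq[where Q = "\<lambda>u k. (turan_op ^^ s) (qmult_coeff r u) k > 0"])
       (rule qmult_sequence.eventually_turan_iterate_pos)
  then have "\<forall>\<^sub>F x in F. \<forall>s \<in> {1..d}. \<forall>k \<in> window C r (ns x). (turan_op ^^ s) (qmult_coeff r (ns x)) k > 0"
    by (intro eventually_ball_finite) auto
  then show "\<forall>\<^sub>F x in F. \<forall>s \<in> {1..d}. \<forall>k \<in> window C r (ns x). (turan_op ^^ s) (qmult_coeff r (ns x)) k \<ge> 0"
    by eventually_elim (auto intro: less_imp_le)
qed

end
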